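(* Let $\mathcal{D}$ be an $(m/n)$-Calabi-Yau triangulated category. For any functorially finite thick subcategory $\mathcal{U}_1$ of $\mathcal{D}$, put $\mathcal{U}_{i+1}:=\mathcal{U}_i^{\perp}$ for any $i$. Then $(\mathcal{U}_1,\dots,\mathcal{U}_l)$ is an $l$-gon of recollements in $\mathcal{D}$ for some positive divisor $l$ of $2n$.
   Context: Let $k$ be a field and $D=\operatorname{Hom}_k(-,k)$. Let $\mathcal{D}$ be a $k$-linear triangulated category with translation $\Sigma$ and $\dim_k\operatorname{Hom}_{\mathcal{D}}(X,Y)<\infty$ for all $X,Y\in\mathcal{D}$. A Serre functor of $\mathcal{D}$ is an autofunctor $S:\mathcal{D}\to\mathcal{D}$ for which there is a functorial isomorphism $\operatorname{Hom}_{\mathcal{D}}(X,Y)\simeq D\operatorname{Hom}_{\mathcal{D}}(Y,SX)$ for all $X,Y\in\mathcal{D}$. For a positive integer $n$ and an integer $m$, $\mathcal{D}$ is $(m/n)$-Calabi-Yau if it has a Serre functor $S$ and there is an isomorphism of functors $S^n\simeq\Sigma^m$ (common divisors of $m$ and $n$ may not be cancelled). For a full subcategory $\mathcal{U}\subset\mathcal{D}$, $\mathcal{U}^{\perp}=\{T\in\mathcal{D}\mid\operatorname{Hom}_{\mathcal{D}}(\mathcal{U},T)=0\}$. A morphism $f:U_X\to X$ with $U_X\in\mathcal{U}$ is a right $\mathcal{U}$-approximation if $\operatorname{Hom}_{\mathcal{D}}(U,f)$ is surjective for all $U\in\mathcal{U}$; $\mathcal{U}$ is contravariantly finite if every object of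 $\mathcal{D}$ has a right $\mathcal{U}$-approximation; covariantly finite is defined dually; functorially finite means both. Thick means full triangulated and closed under direct summands. A pair $(\mathcal{U},\mathcal{V})$ of full subcategories is a stable t-structure in $\mathcal{D}$ if $\mathcal{U}=\Sigma\mathcal{U}$, $\mathcal{V}=\Sigma\mathcal{V}$, $\operatorname{Hom}_{\mathcal{D}}(\mathcal{U},\mathcal{V})=0$, and every $X\in\mathcal{D}$ sits in a triangle $U\to X\to V\to\Sigma U$ with $U\in\mathcal{U}$, $V\in\mathcal{V}$. An $l$-tuple $(\mathcal{U}_1,\dots,\mathcal{U}_l)$ of full triangulated subcategories is an $l$-gon of recollements in $\mathcal{D}$ if $(\mathcal{U}_i,\mathcal{U}_{i+1})$ is a stable t-structure for $1\le i\le l$, where $\mathcal{U}_{l+1}=\mathcal{U}_1$.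
   Formalization: Added assumption: every idempotent endomorphism of an object of U_1 splits in D (automatic if D is idempotent complete); without it the claim fails, e.g. for pairs (V,W) in D^b(k×k) with even total Euler characteristic and U_1 = {(V,0)}. *)

theory Defs
  imports "HOL-Algebra.Module"
begin

section \<open>Vector spaces and duals\<close>

text \<open>
  A vector space over a field \<open>K\<close> is a \<open>K\<close>-module in the sense of HOL-Algebra; the fields
  \<open>mult\<close> and \<open>one\<close> of the module record play no role.
\<close>

definition linear_map ::
  "('k, 'x) ring_scheme \<Rightarrow> ('k, 'a, 'y) module_scheme \<Rightarrow> ('k, 'b, 'z) module_scheme \<Rightarrow> ('a \<Rightarrow> 'b) \<Rightarrow> bool"
where
  "linear_map K V W f \<longleftrightarrow>
     f \<in> carrier V \<rightarrow> carrier W \<and>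
     (\<forall>u\<in>carrier V. \<forall>v\<in>carrier V. f (u \<oplus>\<^bsub>V\<^esub> v) = f u \<oplus>\<^bsub>W\<^esub> f v) \<and>
     (\<forall>a\<in>carrier K. \<forall>v\<in>carrier V. f (a \<odot>\<^bsub>V\<^esub> v) = a \<odot>\<^bsub>W\<^esub> f v)"

definition linear_iso ::
  "('k, 'x) ring_scheme \<Rightarrow> ('k, 'a, 'y) module_scheme \<Rightarrow> ('k, 'b, 'z) module_scheme \<Rightarrow> ('a \<Rightarrow> 'b) \<Rightarrow> bool"
where
  "linear_iso K V W f \<longleftrightarrow> linear_map K V W f \<and> bij_betw f (carrier V) (carrier W)"

definition finite_dimensional_space ::
  "('k, 'x) ring_scheme \<Rightarrow> ('k, 'a, 'y) module_scheme \<Rightarrow> bool"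
where
  "finite_dimensional_space K V \<longleftrightarrow>
     (\<exists>B. finite B \<and> B \<subseteq> carrier V \<and>
        (\<forall>v\<in>carrier V. \<exists>a \<in> B \<rightarrow> carrier K. v = (\<Oplus>\<^bsub>V\<^esub>b\<in>B. a b \<odot>\<^bsub>V\<^esub> b)))"

definition scalar_space :: "('k, 'x) ring_scheme \<Rightarrow> ('k, 'k) module" where
  "scalar_space K =
     \<lparr>carrier = carrier K, mult = mult K, one = one K, zero = zero K, add = add K, smult = mult K\<rparr>"

text \<open>Functionals are taken extensional, so that equality in the dual is equality on \<open>carrier V\<close>.\<close>

definition dual_space :: "('k, 'x) ring_scheme \<Rightarrow> ('k, 'a, 'y) module_scheme \<Rightarrow> ('k, 'a \<Rightarrow> 'k) module" where
  "dual_space K V =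
     \<lparr>carrier = {\<phi> \<in> extensional (carrier V). linear_map K V (scalar_space K) \<phi>},
      mult = undefined, one = undefined,
      zero = (\<lambda>v\<in>carrier V. \<zero>\<^bsub>K\<^esub>),
      add = (\<lambda>\<phi> \<psi>. \<lambda>v\<in>carrier V. \<phi> v \<oplus>\<^bsub>K\<^esub> \<psi> v),
      smult = (\<lambda>a \<phi>. \<lambda>v\<in>carrier V. a \<otimes>\<^bsub>K\<^esub> \<phi> v)\<rparr>"


section \<open>Linear categories\<close>

record ('o, 'm, 'k) klcat =
  Ob :: "'o set"
  Hom :: "'o \<Rightarrow> 'o \<Rightarrow> ('k, 'm) module"
  Idm :: "'o \<Rightarrow> 'm"
  Cmp :: "'m \<Rightarrow> 'm \<Rightarrow> 'm"  (infixl "\<bullet>\<index>" 70)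

abbreviation Mor :: "('o, 'm, 'k, 'z) klcat_scheme \<Rightarrow> 'o \<Rightarrow> 'o \<Rightarrow> 'm set" where
  "Mor C X Y \<equiv> carrier (Hom C X Y)"

text \<open>
  Hom-sets are pairwise disjoint, so a morphism determines its source and target and
  composition needs no object arguments; \<open>g \<bullet> f\<close> means \<open>f\<close> followed by \<open>g\<close>.
\<close>

locale k_linear_category = field K
  for K :: "('k, 'x) ring_scheme" and C :: "('o, 'm, 'k, 'z) klcat_scheme" +
  assumes Hom_module: "\<lbrakk>X \<in> Ob C; Y \<in> Ob C\<rbrakk> \<Longrightarrow> module K (Hom C X Y)"
    and Hom_disjoint:
      "\<lbrakk>X \<in> Ob C; Y \<in> Ob C; X' \<in> Ob C; Y' \<in> Ob C; f \<in> Mor C X Y; f \<in> Mor C X' Y'\<rbrakk>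
         \<Longrightarrow> X = X' \<and> Y = Y'"
    and Idm_closed: "X \<in> Ob C \<Longrightarrow> Idm C X \<in> Mor C X X"
    and Cmp_linear_right:
      "\<lbrakk>X \<in> Ob C; Y \<in> Ob C; Z \<in> Ob C; g \<in> Mor C Y Z\<rbrakk>
         \<Longrightarrow> linear_map K (Hom C X Y) (Hom C X Z) (\<lambda>f. g \<bullet>\<^bsub>C\<^esub> f)"
    and Cmp_linear_left:
      "\<lbrakk>X \<in> Ob C; Y \<in> Ob C; Z \<in> Ob C; f \<in> Mor C X Y\<rbrakk>
         \<Longrightarrow> linear_map K (Hom C Y Z) (Hom C X Z) (\<lambda>g. g \<bullet>\<^bsub>C\<^esub> f)"
    and Cmp_assoc:
      "\<lbrakk>W \<in> Ob C; X \<in> Ob C; Y \<in> Ob C; Z \<in> Ob C; f \<in> Mor C W X; g \<in> Mor C X Y; h \<in> Mor C Y Z\<rbrakk>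
         \<Longrightarrow> (h \<bullet>\<^bsub>C\<^esub> g) \<bullet>\<^bsub>C\<^esub> f = h \<bullet>\<^bsub>C\<^esub> (g \<bullet>\<^bsub>C\<^esub> f)"
    and Cmp_Idm_right: "\<lbrakk>X \<in> Ob C; Y \<in> Ob C; f \<in> Mor C X Y\<rbrakk> \<Longrightarrow> f \<bullet>\<^bsub>C\<^esub> Idm C X = f"
    and Cmp_Idm_left: "\<lbrakk>X \<in> Ob C; Y \<in> Ob C; f \<in> Mor C X Y\<rbrakk> \<Longrightarrow> Idm C Y \<bullet>\<^bsub>C\<^esub> f = f"

definition is_iso :: "('o, 'm, 'k, 'z) klcat_scheme \<Rightarrow> 'o \<Rightarrow> 'o \<Rightarrow> 'm \<Rightarrow> bool" where
  "is_iso C X Y f \<longleftrightarrow>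
     f \<in> Mor C X Y \<and> (\<exists>g\<in>Mor C Y X. g \<bullet>\<^bsub>C\<^esub> f = Idm C X \<and> f \<bullet>\<^bsub>C\<^esub> g = Idm C Y)"

definition isomorphic :: "('o, 'm, 'k, 'z) klcat_scheme \<Rightarrow> 'o \<Rightarrow> 'o \<Rightarrow> bool" where
  "isomorphic C X Y \<longleftrightarrow> (\<exists>f. is_iso C X Y f)"

definition zero_object :: "('o, 'm, 'k, 'z) klcat_scheme \<Rightarrow> 'o \<Rightarrow> bool" where
  "zero_object C Z \<longleftrightarrow>
     Z \<in> Ob C \<and> (\<forall>X\<in>Ob C. Mor C X Z = {\<zero>\<^bsub>Hom C X Z\<^esub>} \<and> Mor C Z X = {\<zero>\<^bsub>Hom C Z X\<^esub>})"

definition direct_sum ::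
  "('o, 'm, 'k, 'z) klcat_scheme \<Rightarrow> 'o \<Rightarrow> 'o \<Rightarrow> 'o \<Rightarrow> bool"
where
  "direct_sum C X Y W \<longleftrightarrow>
     X \<in> Ob C \<and> Y \<in> Ob C \<and> W \<in> Ob C \<and>
     (\<exists>i\<in>Mor C X W. \<exists>j\<in>Mor C Y W. \<exists>p\<in>Mor C W X. \<exists>q\<in>Mor C W Y.
        p \<bullet>\<^bsub>C\<^esub> i = Idm C X \<and> q \<bullet>\<^bsub>C\<^esub> j = Idm C Y \<and>
        p \<bullet>\<^bsub>C\<^esub> j = \<zero>\<^bsub>Hom C Y X\<^esub> \<and> q \<bullet>\<^bsub>C\<^esub> i = \<zero>\<^bsub>Hom C X Y\<^esub> \<and>
        (i \<bullet>\<^bsub>C\<^esub> p) \<oplus>\<^bsub>Hom C W W\<^esub> (j \<bullet>\<^bsub>C\<^esub> q) = Idm C W)"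

locale k_linear_additive_category = k_linear_category +
  assumes zero_object_exists: "\<exists>Z. zero_object C Z"
    and direct_sum_exists: "\<lbrakk>X \<in> Ob C; Y \<in> Ob C\<rbrakk> \<Longrightarrow> \<exists>W. direct_sum C X Y W"

definition hom_finite :: "('k, 'x) ring_scheme \<Rightarrow> ('o, 'm, 'k, 'z) klcat_scheme \<Rightarrow> bool" where
  "hom_finite K C \<longleftrightarrow> (\<forall>X\<in>Ob C. \<forall>Y\<in>Ob C. finite_dimensional_space K (Hom C X Y))"


section \<open>Endofunctors\<close>

record ('o, 'm) endo =
  fob :: "'o \<Rightarrow> 'o"
  fmor :: "'m \<Rightarrow> 'm"

definition endofunctor :: "('o, 'm, 'k, 'z) klcat_scheme \<Rightarrow> ('o, 'm) endo \<Rightarrow> bool" where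
  "endofunctor C F \<longleftrightarrow>
     (\<forall>X\<in>Ob C. fob F X \<in> Ob C \<and> fmor F (Idm C X) = Idm C (fob F X)) \<and>
     (\<forall>X\<in>Ob C. \<forall>Y\<in>Ob C. \<forall>f\<in>Mor C X Y. fmor F f \<in> Mor C (fob F X) (fob F Y)) \<and>
     (\<forall>X\<in>Ob C. \<forall>Y\<in>Ob C. \<forall>Z\<in>Ob C. \<forall>f\<in>Mor C X Y. \<forall>g\<in>Mor C Y Z.
        fmor F (g \<bullet>\<^bsub>C\<^esub> f) = fmor F g \<bullet>\<^bsub>C\<^esub> fmor F f)"

definition linear_endofunctor ::
  "('k, 'x) ring_scheme \<Rightarrow> ('o, 'm, 'k, 'z) klcat_scheme \<Rightarrow> ('o, 'm) endo \<Rightarrow> bool"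
where
  "linear_endofunctor K C F \<longleftrightarrow>
     endofunctor C F \<and>
     (\<forall>X\<in>Ob C. \<forall>Y\<in>Ob C. linear_map K (Hom C X Y) (Hom C (fob F X) (fob F Y)) (fmor F))"

definition id_endo :: "('o, 'm) endo" where
  "id_endo = \<lparr>fob = id, fmor = id\<rparr>"

definition comp_endo :: "('o, 'm) endo \<Rightarrow> ('o, 'm) endo \<Rightarrow> ('o, 'm) endo" where
  "comp_endo F G = \<lparr>fob = fob F \<circ> fob G, fmor = fmor F \<circ> fmor G\<rparr>"

definition power_endo :: "('o, 'm) endo \<Rightarrow> nat \<Rightarrow> ('o, 'm) endo" where
  "power_endo F n = \<lparr>fob = fob F ^^ n, fmor = fmor F ^^ n\<rparr>"

definition naturally_isomorphic ::
  "('o, 'm, 'k, 'z) klcat_scheme \<Rightarrow> ('o, 'm) endo \<Rightarrow> ('o, 'm) endo \<Rightarrow> bool"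
where
  "naturally_isomorphic C F G \<longleftrightarrow>
     (\<exists>\<alpha>. (\<forall>X\<in>Ob C. is_iso C (fob F X) (fob G X) (\<alpha> X)) \<and>
          (\<forall>X\<in>Ob C. \<forall>Y\<in>Ob C. \<forall>f\<in>Mor C X Y. \<alpha> Y \<bullet>\<^bsub>C\<^esub> fmor F f = fmor G f \<bullet>\<^bsub>C\<^esub> \<alpha> X))"

definition quasi_inverse ::
  "('o, 'm, 'k, 'z) klcat_scheme \<Rightarrow> ('o, 'm) endo \<Rightarrow> ('o, 'm) endo \<Rightarrow> bool"
where
  "quasi_inverse C F G \<longleftrightarrow>
     endofunctor C F \<and> endofunctor C G \<and>
     naturally_isomorphic C (comp_endo G F) id_endo \<and>
     naturally_isomorphic C (comp_endo F G) id_endo"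

definition autoequivalence :: "('o, 'm, 'k, 'z) klcat_scheme \<Rightarrow> ('o, 'm) endo \<Rightarrow> bool" where
  "autoequivalence C F \<longleftrightarrow> (\<exists>G. quasi_inverse C F G)"

text \<open>Here \<open>G\<close> is meant to be a quasi-inverse of \<open>F\<close>; it supplies the negative powers.\<close>

definition int_power_endo :: "('o, 'm) endo \<Rightarrow> ('o, 'm) endo \<Rightarrow> int \<Rightarrow> ('o, 'm) endo" where
  "int_power_endo F G m = (if 0 \<le> m then power_endo F (nat m) else power_endo G (nat (- m)))"

text \<open>Full subcategories are given by their sets of objects; \<open>F \<U>\<close> is the essential image.\<close>

definition essential_image ::
  "('o, 'm, 'k, 'z) klcat_scheme \<Rightarrow> ('o, 'm) endo \<Rightarrow> 'o set \<Rightarrow> 'o set"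
where
  "essential_image C F \<U> = {Y \<in> Ob C. \<exists>X\<in>\<U>. isomorphic C (fob F X) Y}"


section \<open>Triangulated categories\<close>

text \<open>
  \<open>(X, Y, Z, f, g, h) \<in> Tri D\<close> means that \<open>X \<rightarrow> Y \<rightarrow> Z \<rightarrow> \<Sigma>X\<close>, with maps \<open>f\<close>, \<open>g\<close>, \<open>h\<close>,
  is a distinguished triangle. The translation is only required to be an equivalence,
  not an isomorphism, of categories.
\<close>

record ('o, 'm, 'k) tricat = "('o, 'm, 'k) klcat" +
  Shift :: "('o, 'm) endo"
  Tri :: "('o \<times> 'o \<times> 'o \<times> 'm \<times> 'm \<times> 'm) set"

abbreviation sh :: "('o, 'm, 'k, 'z) tricat_scheme \<Rightarrow> 'o \<Rightarrow> 'o" where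
  "sh D \<equiv> fob (Shift D)"

abbreviation shm :: "('o, 'm, 'k, 'z) tricat_scheme \<Rightarrow> 'm \<Rightarrow> 'm" where
  "shm D \<equiv> fmor (Shift D)"

definition candidate_triangle ::
  "('o, 'm, 'k, 'z) tricat_scheme \<Rightarrow> 'o \<times> 'o \<times> 'o \<times> 'm \<times> 'm \<times> 'm \<Rightarrow> bool"
where
  "candidate_triangle D = (\<lambda>(X, Y, Z, f, g, h).
     X \<in> Ob D \<and> Y \<in> Ob D \<and> Z \<in> Ob D \<and>
     f \<in> Mor D X Y \<and> g \<in> Mor D Y Z \<and> h \<in> Mor D Z (sh D X))"

locale k_linear_triangulated_category = k_linear_additive_category K D
  for K :: "('k, 'x) ring_scheme" and D :: "('o, 'm, 'k, 'z) tricat_scheme" +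
  assumes Shift_linear: "linear_endofunctor K D (Shift D)"
    and Shift_autoequivalence: "autoequivalence D (Shift D)"
    and Tri_candidate: "T \<in> Tri D \<Longrightarrow> candidate_triangle D T"
    and TR1_iso:
      "\<lbrakk>(X, Y, Z, f, g, h) \<in> Tri D; candidate_triangle D (X', Y', Z', f', g', h');
        is_iso D X X' a; is_iso D Y Y' b; is_iso D Z Z' c;
        b \<bullet>\<^bsub>D\<^esub> f = f' \<bullet>\<^bsub>D\<^esub> a; c \<bullet>\<^bsub>D\<^esub> g = g' \<bullet>\<^bsub>D\<^esub> b; shm D a \<bullet>\<^bsub>D\<^esub> h = h' \<bullet>\<^bsub>D\<^esub> c\<rbrakk>
         \<Longrightarrow> (X', Y', Z', f', g', h') \<in> Tri D"
    and TR1_id: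
      "\<lbrakk>X \<in> Ob D; zero_object D Z\<rbrakk>
         \<Longrightarrow> (X, X, Z, Idm D X, \<zero>\<^bsub>Hom D X Z\<^esub>, \<zero>\<^bsub>Hom D Z (sh D X)\<^esub>) \<in> Tri D"
    and TR1_cone:
      "\<lbrakk>X \<in> Ob D; Y \<in> Ob D; f \<in> Mor D X Y\<rbrakk> \<Longrightarrow> \<exists>Z g h. (X, Y, Z, f, g, h) \<in> Tri D"
    and TR2:
      "candidate_triangle D (X, Y, Z, f, g, h) \<Longrightarrow>
         (X, Y, Z, f, g, h) \<in> Tri D \<longleftrightarrow>
         (Y, Z, sh D X, g, h, \<ominus>\<^bsub>Hom D (sh D X) (sh D Y)\<^esub> (shm D f)) \<in> Tri D"
    and TR3:
      "\<lbrakk>(X, Y, Z, f, g, h) \<in> Tri D; (X', Y', Z', f', g', h') \<in> Tri D;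
        a \<in> Mor D X X'; b \<in> Mor D Y Y'; b \<bullet>\<^bsub>D\<^esub> f = f' \<bullet>\<^bsub>D\<^esub> a\<rbrakk>
         \<Longrightarrow> \<exists>c\<in>Mor D Z Z'. c \<bullet>\<^bsub>D\<^esub> g = g' \<bullet>\<^bsub>D\<^esub> b \<and> shm D a \<bullet>\<^bsub>D\<^esub> h = h' \<bullet>\<^bsub>D\<^esub> c"
    and TR4:
      "\<lbrakk>(X, Y, Z', f, i, i') \<in> Tri D; (Y, Z, X', g, j, j') \<in> Tri D;
        (X, Z, Y', g \<bullet>\<^bsub>D\<^esub> f, k, k') \<in> Tri D\<rbrakk>
         \<Longrightarrow> \<exists>u\<in>Mor D Z' Y'. \<exists>v\<in>Mor D Y' X'.
               (Z', Y', X', u, v, shm D i \<bullet>\<^bsub>D\<^esub> j') \<in> Tri D \<and>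
               u \<bullet>\<^bsub>D\<^esub> i = k \<bullet>\<^bsub>D\<^esub> g \<and> k' \<bullet>\<^bsub>D\<^esub> u = i' \<and>
               v \<bullet>\<^bsub>D\<^esub> k = j \<and> j' \<bullet>\<^bsub>D\<^esub> v = shm D f \<bullet>\<^bsub>D\<^esub> k'"


section \<open>Serre functors and fractionally Calabi-Yau categories\<close>

text \<open>
  The two last conjuncts say that \<open>\<eta> X Y: Hom(X, Y) \<rightarrow> D Hom(Y, S X)\<close> is natural in \<open>Y\<close> and
  in \<open>X\<close>: covariantly along \<open>b: Y \<rightarrow> Y'\<close>, contravariantly along \<open>a: X' \<rightarrow> X\<close>.
\<close>

definition serre_functor ::
  "('k, 'x) ring_scheme \<Rightarrow> ('o, 'm, 'k, 'z) klcat_scheme \<Rightarrow> ('o, 'm) endo \<Rightarrow> bool"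
where
  "serre_functor K C S \<longleftrightarrow>
     autoequivalence C S \<and>
     (\<exists>\<eta>.
        (\<forall>X\<in>Ob C. \<forall>Y\<in>Ob C.
           linear_iso K (Hom C X Y) (dual_space K (Hom C Y (fob S X))) (\<eta> X Y)) \<and>
        (\<forall>X\<in>Ob C. \<forall>Y\<in>Ob C. \<forall>Y'\<in>Ob C. \<forall>f\<in>Mor C X Y. \<forall>b\<in>Mor C Y Y'. \<forall>t\<in>Mor C Y' (fob S X).
           \<eta> X Y' (b \<bullet>\<^bsub>C\<^esub> f) t = \<eta> X Y f (t \<bullet>\<^bsub>C\<^esub> b)) \<and>
        (\<forall>X\<in>Ob C. \<forall>X'\<in>Ob C. \<forall>Y\<in>Ob C. \<forall>f\<in>Mor C X Y. \<forall>a\<in>Mor C X' X. \<forall>t\<in>Mor C Y (fob S X').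
           \<eta> X' Y (f \<bullet>\<^bsub>C\<^esub> a) t = \<eta> X Y f (fmor S a \<bullet>\<^bsub>C\<^esub> t)))"

text \<open>
  The pair \<open>(m, n)\<close> is kept as such, without cancelling common divisors. A quasi-inverse of
  the translation is unique up to isomorphism, so the choice of \<open>\<Sigma>'\<close> does not matter.
\<close>

definition fractionally_calabi_yau ::
  "('k, 'x) ring_scheme \<Rightarrow> ('o, 'm, 'k, 'z) tricat_scheme \<Rightarrow> int \<Rightarrow> nat \<Rightarrow> bool"
where
  "fractionally_calabi_yau K D m n \<longleftrightarrow>
     0 < n \<and>
     (\<exists>S \<Sigma>'. serre_functor K D S \<and> quasi_inverse D (Shift D) \<Sigma>' \<and>
        naturally_isomorphic D (power_endo S n) (int_power_endo (Shift D) \<Sigma>' m))"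


section \<open>Subcategories\<close>

definition hom_vanishes :: "('o, 'm, 'k, 'z) klcat_scheme \<Rightarrow> 'o set \<Rightarrow> 'o set \<Rightarrow> bool" where
  "hom_vanishes C \<U> \<V> \<longleftrightarrow> (\<forall>U\<in>\<U>. \<forall>V\<in>\<V>. Mor C U V = {\<zero>\<^bsub>Hom C U V\<^esub>})"

definition right_perp :: "('o, 'm, 'k, 'z) klcat_scheme \<Rightarrow> 'o set \<Rightarrow> 'o set" where
  "right_perp C \<U> = {T \<in> Ob C. hom_vanishes C \<U> {T}}"

definition right_approximation ::
  "('o, 'm, 'k, 'z) klcat_scheme \<Rightarrow> 'o set \<Rightarrow> 'o \<Rightarrow> 'o \<Rightarrow> 'm \<Rightarrow> bool"
where
  "right_approximation C \<U> W X f \<longleftrightarrow>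
     W \<in> \<U> \<and> f \<in> Mor C W X \<and> (\<forall>U\<in>\<U>. (\<lambda>u. f \<bullet>\<^bsub>C\<^esub> u) ` Mor C U W = Mor C U X)"

definition left_approximation ::
  "('o, 'm, 'k, 'z) klcat_scheme \<Rightarrow> 'o set \<Rightarrow> 'o \<Rightarrow> 'o \<Rightarrow> 'm \<Rightarrow> bool"
where
  "left_approximation C \<U> X W f \<longleftrightarrow>
     W \<in> \<U> \<and> f \<in> Mor C X W \<and> (\<forall>U\<in>\<U>. (\<lambda>u. u \<bullet>\<^bsub>C\<^esub> f) ` Mor C W U = Mor C X U)"

definition contravariantly_finite :: "('o, 'm, 'k, 'z) klcat_scheme \<Rightarrow> 'o set \<Rightarrow> bool" where
  "contravariantly_finite C \<U> \<longleftrightarrow> (\<forall>X\<in>Ob C. \<exists>W f. right_approximation C \<U> W X f)"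

definition covariantly_finite :: "('o, 'm, 'k, 'z) klcat_scheme \<Rightarrow> 'o set \<Rightarrow> bool" where
  "covariantly_finite C \<U> \<longleftrightarrow> (\<forall>X\<in>Ob C. \<exists>W f. left_approximation C \<U> X W f)"

definition functorially_finite :: "('o, 'm, 'k, 'z) klcat_scheme \<Rightarrow> 'o set \<Rightarrow> bool" where
  "functorially_finite C \<U> \<longleftrightarrow> contravariantly_finite C \<U> \<and> covariantly_finite C \<U>"

text \<open>Closure under isomorphism is included, as usual for triangulated subcategories.\<close>

definition triangulated_subcategory :: "('o, 'm, 'k, 'z) tricat_scheme \<Rightarrow> 'o set \<Rightarrow> bool" where
  "triangulated_subcategory D \<U> \<longleftrightarrow>
     \<U> \<subseteq> Ob D \<and> (\<exists>Z\<in>\<U>. zero_object D Z) \<and>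
     (\<forall>X\<in>\<U>. \<forall>Y\<in>Ob D. isomorphic D X Y \<longrightarrow> Y \<in> \<U>) \<and>
     essential_image D (Shift D) \<U> = \<U> \<and>
     (\<forall>X Y Z f g h. (X, Y, Z, f, g, h) \<in> Tri D \<and> X \<in> \<U> \<and> Y \<in> \<U> \<longrightarrow> Z \<in> \<U>)"

definition thick_subcategory :: "('o, 'm, 'k, 'z) tricat_scheme \<Rightarrow> 'o set \<Rightarrow> bool" where
  "thick_subcategory D \<U> \<longleftrightarrow>
     triangulated_subcategory D \<U> \<and>
     (\<forall>X Y W. direct_sum D X Y W \<and> W \<in> \<U> \<longrightarrow> X \<in> \<U> \<and> Y \<in> \<U>)"

text \<open>
  Every idempotent endomorphism of an object of \<open>\<U>\<close> splits in \<open>C\<close>. This holds for all \<open>\<U>\<close> when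
  \<open>C\<close> is idempotent complete, i.e., for Hom-finite \<open>C\<close>, when \<open>C\<close> is Krull-Schmidt. Without it,
  a functorially finite thick subcategory need not be part of any stable t-structure: in the
  category of pairs \<open>(V, W)\<close> of finite-dimensional graded spaces whose Euler characteristics
  add up to an even number (with identity Serre functor, hence 0/1-Calabi-Yau), take the
  objects \<open>(V, 0)\<close>; the object \<open>(k, k)\<close> has no triangle decomposing it.
\<close>

definition idempotents_split_on :: "('o, 'm, 'k, 'z) klcat_scheme \<Rightarrow> 'o set \<Rightarrow> bool" where
  "idempotents_split_on C \<U> \<longleftrightarrow>
     (\<forall>U\<in>\<U>. \<forall>e\<in>Mor C U U. e \<bullet>\<^bsub>C\<^esub> e = e \<longrightarrow>
        (\<exists>Y\<in>Ob C. \<exists>p\<in>Mor C U Y. \<exists>i\<in>Mor C Y U. p \<bullet>\<^bsub>C\<^esub> i = Idm C Y \<and> i \<bullet>\<^bsub>C\<^esub> p = e))"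

definition stable_t_structure ::
  "('o, 'm, 'k, 'z) tricat_scheme \<Rightarrow> 'o set \<Rightarrow> 'o set \<Rightarrow> bool"
where
  "stable_t_structure D \<U> \<V> \<longleftrightarrow>
     \<U> \<subseteq> Ob D \<and> \<V> \<subseteq> Ob D \<and>
     \<U> = essential_image D (Shift D) \<U> \<and> \<V> = essential_image D (Shift D) \<V> \<and>
     hom_vanishes D \<U> \<V> \<and>
     (\<forall>X\<in>Ob D. \<exists>U\<in>\<U>. \<exists>V\<in>\<V>. \<exists>f g h. (U, X, V, f, g, h) \<in> Tri D)"

text \<open>The \<open>l\<close>-tuple is \<open>(\<U> 1, \<dots>, \<U> l)\<close>; other values of \<open>\<U>\<close> are irrelevant.\<close>

definition gon_of_recollements ::
  "('o, 'm, 'k, 'z) tricat_scheme \<Rightarrow> nat \<Rightarrow> (nat \<Rightarrow> 'o set) \<Rightarrow> bool"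
where
  "gon_of_recollements D l \<U> \<longleftrightarrow>
     (\<forall>i\<in>{1..l}. triangulated_subcategory D (\<U> i) \<and>
        stable_t_structure D (\<U> i) (if i = l then \<U> 1 else \<U> (i + 1)))"

end

theory Submission
  imports Defs
begin

text \<open>
  A thick subcategory \<open>\<U>\<close> whose idempotents split and which is contravariantly finite is
  coreflective: resolving an approximation of \<open>X\<close> once more and taking the cone gives an object of
  \<open>\<U>\<close> whose represented functor contains \<open>Hom(-, X)\<close> on \<open>\<U>\<close> as a retract. Hence
  \<open>(\<U>, \<U>\<^sup>\<bottom>)\<close> is a stable t-structure, and so is \<open>(\<^sup>\<bottom>\<U>, \<U>)\<close> when \<open>\<U>\<close> is covariantly finite.
  Serre duality gives \<open>\<^sup>\<bottom>(S\<U>) = \<U>\<^sup>\<bottom>\<close> and \<open>\<U>\<^sup>\<bottom>\<^sup>\<bottom> = S\<U>\<close>. In particular \<open>S\<U>\<close> is thick, being a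
  perpendicular category, so it is never needed that \<open>S\<close> is a triangle functor. As \<open>S\<close>
  transports the approximations, the construction can be iterated, and
  \<open>\<U>\<^sub>2\<^sub>n\<^sub>+\<^sub>1 = S\<^sup>n \<U>\<^sub>1 = \<Sigma>\<^sup>m \<U>\<^sub>1 = \<U>\<^sub>1\<close> shows that \<open>l = 2n\<close> works.
\<close>

section \<open>Functionals on finite-dimensional spaces\<close>

text \<open>A right approximation controls only the existence of factorizations, and unless it is
  minimal its cone need not lie in the right perpendicular category. What is missing is uniqueness:
  a coreflection must make \<open>Hom(W, Y) \<rightarrow> Hom(W, X)\<close> bijective for
  \<open>W\<close> in \<open>\<U>\<close>. Two approximations present \<open>Hom(-, X)\<close> on
  \<open>\<U>\<close> as the cokernel of \<open>Hom(-, U') \<rightarrow> Hom(-, U)\<close>. The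
  functor of the cone \<open>V\<close> of \<open>U' \<rightarrow> U\<close> contains this cokernel,
  and the induced map \<open>V \<rightarrow> X\<close> lifts to \<open>U\<close> because
  \<open>V\<close> itself lies in \<open>\<U>\<close>. This lift produces the idempotent of
  \<open>V\<close> whose image is the coreflection. The second member of a pair is treated from the
  other side: \<open>(\<U>\<^sub>2, \<U>\<^sub>3)\<close> is built from left approximations in
  \<open>\<U>\<^sub>3 = S\<U>\<^sub>1\<close>, not from right approximations in
  \<open>\<U>\<^sub>2\<close>. So the odd members carry the approximations, each application of
  \<open>S\<close> advances two places, and \<open>S\<^sup>n\<close> accounts for
  \<open>2n\<close>.\<close>

lemma (in abelian_group) minus_eq_zero_iff:
  assumes "a \<in> carrier G" "b \<in> carrier G"
  shows "a \<ominus> b = \<zero> \<longleftrightarrow> a = b"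
  using assms by (metis a_minus_def add.inv_closed minus_equality r_neg)

text \<open>In a spanning set of least cardinality no member is a combination of the others, so the
  coefficient at one chosen \<open>b\<close> is well defined and linear. Uniqueness has to be shown
  for that coefficient only.\<close>

lemma nonzero_functional_exists:
  fixes K :: "('k, 'x) ring_scheme" and V :: "('k, 'a, 'y) module_scheme"
  assumes "field K" "module K V" "finite_dimensional_space K V" "carrier V \<noteq> {\<zero>\<^bsub>V\<^esub>}"
  shows "\<exists>\<phi>\<in>carrier (dual_space K V). \<exists>v\<in>carrier V. \<phi> v \<noteq> \<zero>\<^bsub>K\<^esub>"
proof -
  interpret K: field K by fact
  interpret V: module K V by fact
  define L where "L a A = (\<Oplus>\<^bsub>V\<^esub>x\<in>A. a x \<odot>\<^bsub>V\<^esub> x)" for a :: "'a \<Rightarrow> 'k" and A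
  define spans where "spans A \<longleftrightarrow> finite A \<and> A \<subseteq> carrier V \<and>
    (\<forall>v\<in>carrier V. \<exists>a\<in>A \<rightarrow> carrier K. v = L a A)" for A
  have "\<exists>A. spans A"
    using assms(3) by (simp add: finite_dimensional_space_def spans_def L_def)
  then obtain B where B: "spans B" and min: "\<And>A. spans A \<Longrightarrow> card B \<le> card A"
    using ex_has_least_nat[of spans _ card] by metis
  have fin: "finite B" and BV: "B \<subseteq> carrier V" using B by (auto simp: spans_def)
  have "B \<noteq> {}"
  proof
    assume "B = {}"
    then have "\<forall>v\<in>carrier V. v = \<zero>\<^bsub>V\<^esub>" using B by (auto simp: spans_def L_def)
    then show False using assms(4) by auto
  qed
  then obtain b where b: "b \<in> B" by blast
  define B' where "B' = B - {b}"
  have B': "B = insert b B'" "b \<notin> B'" "finite B'" "B' \<subseteq> carrier V"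
    using b fin BV by (auto simp: B'_def)
  have bV: "b \<in> carrier V" using b BV by blast
  have closed: "L a A \<in> carrier V" if "a \<in> A \<rightarrow> carrier K" "A \<subseteq> B" for a A
    unfolding L_def using that BV by (intro V.finsum_closed) (auto simp: Pi_iff subset_iff)
  have L_insert: "L a B = a b \<odot>\<^bsub>V\<^esub> b \<oplus>\<^bsub>V\<^esub> L a B'" if "a \<in> B \<rightarrow> carrier K" for a
    unfolding L_def B'(1) using that B' bV by (subst V.finsum_insert) (auto simp: Pi_iff subset_iff)
  have L_add: "L (\<lambda>x. a x \<oplus>\<^bsub>K\<^esub> a' x) A = L a A \<oplus>\<^bsub>V\<^esub> L a' A"
    if "a \<in> A \<rightarrow> carrier K" "a' \<in> A \<rightarrow> carrier K" "A \<subseteq> B" for a a' A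
  proof -
    have "L (\<lambda>x. a x \<oplus>\<^bsub>K\<^esub> a' x) A = (\<Oplus>\<^bsub>V\<^esub>x\<in>A. a x \<odot>\<^bsub>V\<^esub> x \<oplus>\<^bsub>V\<^esub> a' x \<odot>\<^bsub>V\<^esub> x)"
      unfolding L_def using that BV
      by (intro V.finsum_cong') (auto simp: Pi_iff subset_iff V.smult_l_distr)
    also have "\<dots> = L a A \<oplus>\<^bsub>V\<^esub> L a' A"
      unfolding L_def using that BV by (intro V.finsum_addf) (auto simp: Pi_iff subset_iff)
    finally show ?thesis .
  qed
  have L_smult: "L (\<lambda>x. r \<otimes>\<^bsub>K\<^esub> a x) A = r \<odot>\<^bsub>V\<^esub> L a A"
    if "a \<in> A \<rightarrow> carrier K" "r \<in> carrier K" "A \<subseteq> B" for a r A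
  proof -
    have "L (\<lambda>x. r \<otimes>\<^bsub>K\<^esub> a x) A = (\<Oplus>\<^bsub>V\<^esub>x\<in>A. r \<odot>\<^bsub>V\<^esub> (a x \<odot>\<^bsub>V\<^esub> x))"
      unfolding L_def using that BV
      by (intro V.finsum_cong') (auto simp: Pi_iff subset_iff V.smult_assoc1)
    also have "\<dots> = r \<odot>\<^bsub>V\<^esub> L a A"
      unfolding L_def using that BV finite_subset[OF that(3) fin]
      by (intro V.finsum_smult_ldistr[symmetric]) (auto simp: Pi_iff subset_iff)
    finally show ?thesis .
  qed
  have indep: "b \<noteq> L c B'" if c: "c \<in> B' \<rightarrow> carrier K" for c
  proof
    assume bc: "b = L c B'"
    have "\<exists>a\<in>B' \<rightarrow> carrier K. v = L a B'" if v: "v \<in> carrier V" for v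
    proof -
      obtain a where a: "a \<in> B \<rightarrow> carrier K" "v = L a B" using B v by (auto simp: spans_def)
      have aB': "a \<in> B' \<rightarrow> carrier K" "a b \<in> carrier K" using a b by (auto simp: B'_def)
      have "v = a b \<odot>\<^bsub>V\<^esub> L c B' \<oplus>\<^bsub>V\<^esub> L a B'" using L_insert[OF a(1)] a(2) bc by simp
      also have "\<dots> = L (\<lambda>x. a b \<otimes>\<^bsub>K\<^esub> c x \<oplus>\<^bsub>K\<^esub> a x) B'"
        using aB' c B'(1) by (subst L_add) (auto simp: L_smult subset_insertI Pi_iff)
      finally show ?thesis
        using aB' c by (intro bexI[of _ "\<lambda>x. a b \<otimes>\<^bsub>K\<^esub> c x \<oplus>\<^bsub>K\<^esub> a x"]) auto
    qed
    then have "spans B'" using B' by (auto simp: spans_def)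
    from min[OF this] show False using B' fin by (simp add: card_insert_if)
  qed
  have uniq: "a b = a' b"
    if a: "a \<in> B \<rightarrow> carrier K" "a' \<in> B \<rightarrow> carrier K" "L a B = L a' B" for a a'
  proof (rule ccontr)
    assume ne: "a b \<noteq> a' b"
    have aK: "a b \<in> carrier K" "a' b \<in> carrier K" using a b by auto
    \<comment> \<open>The coefficientwise difference, written with the scalar -1 so that
      \<open>L_add\<close> and \<open>L_smult\<close> apply. Its entry at \<open>b\<close> is
      nonzero, so dividing by it expresses \<open>b\<close> through \<open>B'\<close>.\<close>
    define d where "d x = a x \<oplus>\<^bsub>K\<^esub> (\<ominus>\<^bsub>K\<^esub> \<one>\<^bsub>K\<^esub>) \<otimes>\<^bsub>K\<^esub> a' x" for x
    have d: "d \<in> B \<rightarrow> carrier K" "d \<in> B' \<rightarrow> carrier K" using a by (auto simp: d_def B'_def Pi_iff)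
    have db: "d b \<in> carrier K" using d b by auto
    have "d b = a b \<ominus>\<^bsub>K\<^esub> a' b" using aK by (simp add: d_def K.minus_eq K.l_minus)
    then have "d b \<noteq> \<zero>\<^bsub>K\<^esub>" using ne aK by (simp add: K.minus_eq_zero_iff)
    then have u: "d b \<in> Units K" using db by (simp add: K.field_Units)
    have "L d B = L a B \<oplus>\<^bsub>V\<^esub> (\<ominus>\<^bsub>K\<^esub> \<one>\<^bsub>K\<^esub>) \<odot>\<^bsub>V\<^esub> L a' B"
      unfolding d_def using a by (subst L_add) (auto simp: L_smult Pi_iff)
    also have "\<dots> = \<zero>\<^bsub>V\<^esub>"
      using closed[OF a(1)] closed[OF a(2)] a(3) by (simp add: V.smult_l_minus V.r_neg)
    finally have "d b \<odot>\<^bsub>V\<^esub> b \<oplus>\<^bsub>V\<^esub> L d B' = \<zero>\<^bsub>V\<^esub>" using L_insert[OF d(1)] by simp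
    moreover have LB': "L d B' \<in> carrier V" using closed[OF d(2)] B'(1) by auto
    ultimately have eq: "d b \<odot>\<^bsub>V\<^esub> b = \<ominus>\<^bsub>V\<^esub> L d B'"
      using LB' db bV by (intro V.minus_equality[symmetric]) auto
    have inv: "inv\<^bsub>K\<^esub> d b \<in> carrier K" "inv\<^bsub>K\<^esub> d b \<otimes>\<^bsub>K\<^esub> d b = \<one>\<^bsub>K\<^esub>" using u by auto
    have "b = inv\<^bsub>K\<^esub> d b \<odot>\<^bsub>V\<^esub> (d b \<odot>\<^bsub>V\<^esub> b)"
      using V.smult_assoc1[OF inv(1) db bV] inv(2) V.smult_one[OF bV] by simp
    also have "\<dots> = (\<ominus>\<^bsub>K\<^esub> (inv\<^bsub>K\<^esub> d b)) \<odot>\<^bsub>V\<^esub> L d B'"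
      using inv LB' by (simp add: eq V.smult_r_minus V.smult_l_minus)
    also have "\<dots> = L (\<lambda>x. (\<ominus>\<^bsub>K\<^esub> (inv\<^bsub>K\<^esub> d b)) \<otimes>\<^bsub>K\<^esub> d x) B'"
      using inv d B'(1) by (subst L_smult) auto
    finally show False using indep[of "\<lambda>x. (\<ominus>\<^bsub>K\<^esub> (inv\<^bsub>K\<^esub> d b)) \<otimes>\<^bsub>K\<^esub> d x"] inv d by auto
  qed
  \<comment> \<open>By \<open>uniq\<close> the choice does not matter; the restriction puts
    \<open>\<phi>\<close> into the extensional carrier of the dual.\<close>
  define \<phi> where "\<phi> = (\<lambda>v\<in>carrier V. SOME r. \<exists>a\<in>B \<rightarrow> carrier K. v = L a B \<and> r = a b)"
  have \<phi>L: "\<phi> (L a B) = a b" if "a \<in> B \<rightarrow> carrier K" for a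
    unfolding \<phi>_def using that closed[OF that]
    by (simp, intro some_equality) (auto intro: uniq)
  have rep: "\<exists>a\<in>B \<rightarrow> carrier K. v = L a B" if "v \<in> carrier V" for v
    using B that by (auto simp: spans_def)
  have bK: "a b \<in> carrier K" if "a \<in> B \<rightarrow> carrier K" for a using that b by auto
  have "\<phi> \<in> carrier V \<rightarrow> carrier K"
  proof
    fix v assume "v \<in> carrier V"
    then obtain a where "a \<in> B \<rightarrow> carrier K" "v = L a B" using rep by blast
    then show "\<phi> v \<in> carrier K" using \<phi>L bK by simp
  qed
  moreover have "\<phi> (u \<oplus>\<^bsub>V\<^esub> v) = \<phi> u \<oplus>\<^bsub>K\<^esub> \<phi> v" if uv: "u \<in> carrier V" "v \<in> carrier V" for u v
  proof -
    obtain a a' where a: "a \<in> B \<rightarrow> carrier K" "u = L a B" "a' \<in> B \<rightarrow> carrier K" "v = L a' B"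
      using rep uv by meson
    have "u \<oplus>\<^bsub>V\<^esub> v = L (\<lambda>x. a x \<oplus>\<^bsub>K\<^esub> a' x) B" using a by (simp add: L_add)
    then show ?thesis using a \<phi>L[of "\<lambda>x. a x \<oplus>\<^bsub>K\<^esub> a' x"] by (auto simp: \<phi>L Pi_iff)
  qed
  moreover have "\<phi> (r \<odot>\<^bsub>V\<^esub> v) = r \<otimes>\<^bsub>K\<^esub> \<phi> v" if rv: "r \<in> carrier K" "v \<in> carrier V" for r v
  proof -
    obtain a where a: "a \<in> B \<rightarrow> carrier K" "v = L a B" using rep rv by meson
    have "r \<odot>\<^bsub>V\<^esub> v = L (\<lambda>x. r \<otimes>\<^bsub>K\<^esub> a x) B" using a rv by (simp add: L_smult)
    then show ?thesis using a rv \<phi>L[of "\<lambda>x. r \<otimes>\<^bsub>K\<^esub> a x"] by (auto simp: \<phi>L Pi_iff)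
  qed
  moreover have "\<phi> \<in> extensional (carrier V)" by (simp add: \<phi>_def)
  ultimately have "\<phi> \<in> carrier (dual_space K V)"
    by (simp add: dual_space_def linear_map_def scalar_space_def)
  \<comment> \<open>The sum of all members of \<open>B\<close> has coefficient one at
    \<open>b\<close>.\<close>
  moreover have "\<phi> (L (\<lambda>_. \<one>\<^bsub>K\<^esub>) B) \<noteq> \<zero>\<^bsub>K\<^esub>" "L (\<lambda>_. \<one>\<^bsub>K\<^esub>) B \<in> carrier V"
    using closed[of "\<lambda>_. \<one>\<^bsub>K\<^esub>" B] by (simp_all add: \<phi>L)
  ultimately show ?thesis by blast
qed

text \<open>Being a singleton is invariant under bare bijections, so in this form the statement can
  be transported along a Serre isomorphism without asking where zero goes.\<close>

lemma dual_space_trivial_iff: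
  assumes "field K" "module K V" "finite_dimensional_space K V"
  shows "is_singleton (carrier (dual_space K V)) \<longleftrightarrow> carrier V = {\<zero>\<^bsub>V\<^esub>}"
proof -
  interpret K: field K by fact
  interpret V: module K V by fact
  have zero: "(\<lambda>v\<in>carrier V. \<zero>\<^bsub>K\<^esub>) \<in> carrier (dual_space K V)"
    by (auto simp: dual_space_def linear_map_def scalar_space_def)
  have val: "\<phi> \<zero>\<^bsub>V\<^esub> = \<zero>\<^bsub>K\<^esub>" if "\<phi> \<in> carrier (dual_space K V)" for \<phi>
  proof -
    have lin: "\<phi> \<in> carrier V \<rightarrow> carrier K" "\<phi> (\<zero>\<^bsub>V\<^esub> \<oplus>\<^bsub>V\<^esub> \<zero>\<^bsub>V\<^esub>) = \<phi> \<zero>\<^bsub>V\<^esub> \<oplus>\<^bsub>K\<^esub> \<phi> \<zero>\<^bsub>V\<^esub>"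
      using that by (auto simp: dual_space_def linear_map_def scalar_space_def simp del: V.l_zero V.r_zero)
    then show ?thesis
      by (metis K.add.r_cancel_one' V.l_zero V.zero_closed funcset_mem)
  qed
  show ?thesis
  proof
    assume "is_singleton (carrier (dual_space K V))"
    then have "\<phi> = (\<lambda>v\<in>carrier V. \<zero>\<^bsub>K\<^esub>)" if "\<phi> \<in> carrier (dual_space K V)" for \<phi>
      using zero that by (metis is_singletonE singletonD)
    then show "carrier V = {\<zero>\<^bsub>V\<^esub>}" using nonzero_functional_exists[OF assms] by fastforce
  next
    assume V: "carrier V = {\<zero>\<^bsub>V\<^esub>}"
    have "\<phi> = (\<lambda>v\<in>carrier V. \<zero>\<^bsub>K\<^esub>)" if \<phi>: "\<phi> \<in> carrier (dual_space K V)" for \<phi>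
    proof (rule extensionalityI)
      show "\<phi> \<in> extensional (carrier V)" using \<phi> by (simp add: dual_space_def)
      show "\<phi> v = (\<lambda>v\<in>carrier V. \<zero>\<^bsub>K\<^esub>) v" if "v \<in> carrier V" for v
        using val[OF \<phi>] V that by simp
    qed simp
    then show "is_singleton (carrier (dual_space K V))" using zero by (intro is_singletonI') auto
  qed
qed

section \<open>Morphisms in linear categories\<close>

context k_linear_category
begin

text \<open>Recording the source and target objects along with a morphism makes composition rules chain.\<close>

definition arr :: "'o \<Rightarrow> 'o \<Rightarrow> 'm \<Rightarrow> bool" where
  "arr X Y f \<longleftrightarrow> X \<in> Ob C \<and> Y \<in> Ob C \<and> f \<in> Mor C X Y"

abbreviation zm :: "'o \<Rightarrow> 'o \<Rightarrow> 'm" where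
  "zm X Y \<equiv> \<zero>\<^bsub>Hom C X Y\<^esub>"

lemma arr_src: "arr X Y f \<Longrightarrow> X \<in> Ob C"
  and arr_tgt: "arr X Y f \<Longrightarrow> Y \<in> Ob C"
  and arr_Mor: "arr X Y f \<Longrightarrow> f \<in> Mor C X Y"
  by (simp_all add: arr_def)

lemma arr_Idm: "X \<in> Ob C \<Longrightarrow> arr X X (Idm C X)"
  by (simp add: arr_def Idm_closed)

lemma arr_comp: "arr X Y f \<Longrightarrow> arr Y Z g \<Longrightarrow> arr X Z (g \<bullet>\<^bsub>C\<^esub> f)"
  using Cmp_linear_right[of X Y Z g] by (auto simp: arr_def linear_map_def)

lemma arr_assoc:
  "arr W X f \<Longrightarrow> arr X Y g \<Longrightarrow> arr Y Z h \<Longrightarrow> (h \<bullet>\<^bsub>C\<^esub> g) \<bullet>\<^bsub>C\<^esub> f = h \<bullet>\<^bsub>C\<^esub> (g \<bullet>\<^bsub>C\<^esub> f)"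
  using Cmp_assoc[of W X Y Z f g h] by (simp add: arr_def)

lemma comp_id: "arr X Y f \<Longrightarrow> f \<bullet>\<^bsub>C\<^esub> Idm C X = f"
  and id_comp: "arr X Y f \<Longrightarrow> Idm C Y \<bullet>\<^bsub>C\<^esub> f = f"
  using Cmp_Idm_right[of X Y f] Cmp_Idm_left[of X Y f] by (simp_all add: arr_def)

lemma Hom_group: "X \<in> Ob C \<Longrightarrow> Y \<in> Ob C \<Longrightarrow> abelian_group (Hom C X Y)"
  using Hom_module module.axioms(2) by blast

lemma arr_zero: "X \<in> Ob C \<Longrightarrow> Y \<in> Ob C \<Longrightarrow> arr X Y (zm X Y)"
  using Hom_group[of X Y] by (simp add: arr_def abelian_group.axioms(1) abelian_monoid.zero_closed)

lemma arr_minus: "arr X Y f \<Longrightarrow> arr X Y g \<Longrightarrow> arr X Y (f \<ominus>\<^bsub>Hom C X Y\<^esub> g)"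
  using Hom_group[of X Y] by (simp add: arr_def abelian_group.minus_closed)

lemma arr_neg: "arr X Y f \<Longrightarrow> arr X Y (\<ominus>\<^bsub>Hom C X Y\<^esub> f)"
  using Hom_group[of X Y] by (simp add: arr_def abelian_group.a_inv_closed)

lemma neg_neg: "arr X Y f \<Longrightarrow> \<ominus>\<^bsub>Hom C X Y\<^esub> (\<ominus>\<^bsub>Hom C X Y\<^esub> f) = f"
  using Hom_group[of X Y] by (simp add: arr_def abelian_group.minus_minus)

lemma minus_zero_iff: "arr X Y f \<Longrightarrow> arr X Y g \<Longrightarrow> f \<ominus>\<^bsub>Hom C X Y\<^esub> g = zm X Y \<longleftrightarrow> f = g"
  using abelian_group.minus_eq_zero_iff[OF Hom_group[of X Y]] by (simp add: arr_def)

section \<open>Additivity of composition\<close>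

lemma linear_map_additive:
  assumes "abelian_group V" "abelian_group W" "linear_map K V W \<phi>" "a \<in> carrier V" "b \<in> carrier V"
  shows "\<phi> \<zero>\<^bsub>V\<^esub> = \<zero>\<^bsub>W\<^esub>" and "\<phi> (\<ominus>\<^bsub>V\<^esub> a) = \<ominus>\<^bsub>W\<^esub> \<phi> a" and "\<phi> (a \<ominus>\<^bsub>V\<^esub> b) = \<phi> a \<ominus>\<^bsub>W\<^esub> \<phi> b"
proof -
  interpret V: abelian_group V by fact
  interpret W: abelian_group W by fact
  have cl: "\<And>x. x \<in> carrier V \<Longrightarrow> \<phi> x \<in> carrier W"
    and add: "\<And>x y. x \<in> carrier V \<Longrightarrow> y \<in> carrier V \<Longrightarrow> \<phi> (x \<oplus>\<^bsub>V\<^esub> y) = \<phi> x \<oplus>\<^bsub>W\<^esub> \<phi> y"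
    using assms(3) by (auto simp: linear_map_def)
  have "\<phi> \<zero>\<^bsub>V\<^esub> \<oplus>\<^bsub>W\<^esub> \<phi> \<zero>\<^bsub>V\<^esub> = \<phi> \<zero>\<^bsub>V\<^esub>"
    using add[of "\<zero>\<^bsub>V\<^esub>" "\<zero>\<^bsub>V\<^esub>"] by simp
  then show zero: "\<phi> \<zero>\<^bsub>V\<^esub> = \<zero>\<^bsub>W\<^esub>"
    using cl[of "\<zero>\<^bsub>V\<^esub>"] by (metis V.zero_closed W.add.r_cancel_one')
  have neg: "\<phi> (\<ominus>\<^bsub>V\<^esub> x) = \<ominus>\<^bsub>W\<^esub> \<phi> x" if "x \<in> carrier V" for x
    using that add[of "\<ominus>\<^bsub>V\<^esub> x" x] zero cl by (intro W.minus_equality[symmetric]) (auto simp: V.l_neg)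
  then show "\<phi> (\<ominus>\<^bsub>V\<^esub> a) = \<ominus>\<^bsub>W\<^esub> \<phi> a" using assms(4) .
  show "\<phi> (a \<ominus>\<^bsub>V\<^esub> b) = \<phi> a \<ominus>\<^bsub>W\<^esub> \<phi> b"
    using assms(4,5) add[of a "\<ominus>\<^bsub>V\<^esub> b"] neg by (simp add: a_minus_def)
qed

lemma comp_zero:
  assumes "arr Y Z g" "X \<in> Ob C" shows "g \<bullet>\<^bsub>C\<^esub> zm X Y = zm X Z"
proof -
  have o: "Y \<in> Ob C" "Z \<in> Ob C" "g \<in> Mor C Y Z" using assms by (auto simp: arr_def)
  show ?thesis
    using linear_map_additive(1)[OF Hom_group Hom_group Cmp_linear_right[OF assms(2) o]]
      o assms(2) arr_zero[of X Y] by (simp add: arr_def)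
qed

lemma zero_comp:
  assumes "arr X Y f" "Z \<in> Ob C" shows "zm Y Z \<bullet>\<^bsub>C\<^esub> f = zm X Z"
proof -
  have o: "X \<in> Ob C" "Y \<in> Ob C" "f \<in> Mor C X Y" using assms by (auto simp: arr_def)
  show ?thesis
    using linear_map_additive(1)[OF Hom_group Hom_group Cmp_linear_left[OF o(1,2) assms(2) o(3)]]
      o assms(2) arr_zero[of Y Z] by (simp add: arr_def)
qed

lemma comp_minus:
  assumes "arr Y Z g" "arr X Y a" "arr X Y b"
  shows "g \<bullet>\<^bsub>C\<^esub> (a \<ominus>\<^bsub>Hom C X Y\<^esub> b) = g \<bullet>\<^bsub>C\<^esub> a \<ominus>\<^bsub>Hom C X Z\<^esub> g \<bullet>\<^bsub>C\<^esub> b"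
proof -
  have o: "X \<in> Ob C" "Y \<in> Ob C" "Z \<in> Ob C" "g \<in> Mor C Y Z" "a \<in> Mor C X Y" "b \<in> Mor C X Y"
    using assms by (auto simp: arr_def)
  show ?thesis
    using linear_map_additive(3)[OF Hom_group Hom_group Cmp_linear_right[OF o(1-4)]] o by simp
qed

lemma minus_comp:
  assumes "arr X Y f" "arr Y Z a" "arr Y Z b"
  shows "(a \<ominus>\<^bsub>Hom C Y Z\<^esub> b) \<bullet>\<^bsub>C\<^esub> f = a \<bullet>\<^bsub>C\<^esub> f \<ominus>\<^bsub>Hom C X Z\<^esub> b \<bullet>\<^bsub>C\<^esub> f"
proof -
  have o: "X \<in> Ob C" "Y \<in> Ob C" "Z \<in> Ob C" "f \<in> Mor C X Y" "a \<in> Mor C Y Z" "b \<in> Mor C Y Z"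
    using assms by (auto simp: arr_def)
  show ?thesis
    using linear_map_additive(3)[OF Hom_group Hom_group Cmp_linear_left[OF o(1-4)]] o by simp
qed

lemma comp_neg:
  assumes "arr Y Z g" "arr X Y a"
  shows "g \<bullet>\<^bsub>C\<^esub> (\<ominus>\<^bsub>Hom C X Y\<^esub> a) = \<ominus>\<^bsub>Hom C X Z\<^esub> (g \<bullet>\<^bsub>C\<^esub> a)"
proof -
  have o: "X \<in> Ob C" "Y \<in> Ob C" "Z \<in> Ob C" "g \<in> Mor C Y Z" "a \<in> Mor C X Y"
    using assms by (auto simp: arr_def)
  show ?thesis
    using linear_map_additive(2)[OF Hom_group Hom_group Cmp_linear_right[OF o(1-4)]] o by simp
qed

lemma neg_comp:
  assumes "arr X Y f" "arr Y Z a"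
  shows "(\<ominus>\<^bsub>Hom C Y Z\<^esub> a) \<bullet>\<^bsub>C\<^esub> f = \<ominus>\<^bsub>Hom C X Z\<^esub> (a \<bullet>\<^bsub>C\<^esub> f)"
proof -
  have o: "X \<in> Ob C" "Y \<in> Ob C" "Z \<in> Ob C" "f \<in> Mor C X Y" "a \<in> Mor C Y Z"
    using assms by (auto simp: arr_def)
  show ?thesis
    using linear_map_additive(2)[OF Hom_group Hom_group Cmp_linear_left[OF o(1-4)]] o by simp
qed

text \<open>Apply the last hypothesis to the difference of \<open>a\<close> and \<open>b\<close>: if
  \<open>c\<close> kills what \<open>f\<close> kills, then \<open>c\<close> identifies what
  \<open>f\<close> identifies. This turns the relations on an approximation into equations for
  \<open>c\<close>.\<close>

lemma comp_cancel_of_zero: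
  assumes "arr Y Z f" "arr Y V c" "arr X Y a" "arr X Y b" "f \<bullet>\<^bsub>C\<^esub> a = f \<bullet>\<^bsub>C\<^esub> b"
    and "\<And>w. arr X Y w \<Longrightarrow> f \<bullet>\<^bsub>C\<^esub> w = zm X Z \<Longrightarrow> c \<bullet>\<^bsub>C\<^esub> w = zm X V"
  shows "c \<bullet>\<^bsub>C\<^esub> a = c \<bullet>\<^bsub>C\<^esub> b"
proof -
  have "f \<bullet>\<^bsub>C\<^esub> (a \<ominus>\<^bsub>Hom C X Y\<^esub> b) = zm X Z"
    using assms(1-5) by (simp add: comp_minus minus_zero_iff arr_comp[OF assms(4,1)])
  then have "c \<bullet>\<^bsub>C\<^esub> (a \<ominus>\<^bsub>Hom C X Y\<^esub> b) = zm X V" using assms arr_minus by blast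
  then show ?thesis
    using assms(2-4) arr_comp[OF assms(3,2)] arr_comp[OF assms(4,2)] by (simp add: comp_minus minus_zero_iff)
qed

lemma cancel_comp_of_zero:
  assumes "arr Z Y f" "arr V Y c" "arr Y X a" "arr Y X b" "a \<bullet>\<^bsub>C\<^esub> f = b \<bullet>\<^bsub>C\<^esub> f"
    and "\<And>w. arr Y X w \<Longrightarrow> w \<bullet>\<^bsub>C\<^esub> f = zm Z X \<Longrightarrow> w \<bullet>\<^bsub>C\<^esub> c = zm V X"
  shows "a \<bullet>\<^bsub>C\<^esub> c = b \<bullet>\<^bsub>C\<^esub> c"
proof -
  have "(a \<ominus>\<^bsub>Hom C Y X\<^esub> b) \<bullet>\<^bsub>C\<^esub> f = zm Z X"
    using assms(1-5) by (simp add: minus_comp minus_zero_iff arr_comp[OF assms(1,4)])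
  then have "(a \<ominus>\<^bsub>Hom C Y X\<^esub> b) \<bullet>\<^bsub>C\<^esub> c = zm V X" using assms arr_minus by blast
  then show ?thesis
    using assms(2-4) arr_comp[OF assms(2,3)] arr_comp[OF assms(2,4)] by (simp add: minus_comp minus_zero_iff)
qed

subsection \<open>Isomorphisms\<close>

lemma is_iso_iff:
  "X \<in> Ob C \<Longrightarrow> Y \<in> Ob C \<Longrightarrow>
   is_iso C X Y f \<longleftrightarrow> arr X Y f \<and> (\<exists>g. arr Y X g \<and> g \<bullet>\<^bsub>C\<^esub> f = Idm C X \<and> f \<bullet>\<^bsub>C\<^esub> g = Idm C Y)"
  by (auto simp: is_iso_def arr_def)

lemma isomorphic_iff:
  "X \<in> Ob C \<Longrightarrow> Y \<in> Ob C \<Longrightarrow> isomorphic C X Y \<longleftrightarrow>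
   (\<exists>f g. arr X Y f \<and> arr Y X g \<and> g \<bullet>\<^bsub>C\<^esub> f = Idm C X \<and> f \<bullet>\<^bsub>C\<^esub> g = Idm C Y)"
  by (auto simp: isomorphic_def is_iso_iff)

lemma isomorphic_refl: "X \<in> Ob C \<Longrightarrow> isomorphic C X X"
  using arr_Idm comp_id isomorphic_iff by metis

lemma isomorphic_sym: "X \<in> Ob C \<Longrightarrow> Y \<in> Ob C \<Longrightarrow> isomorphic C X Y \<Longrightarrow> isomorphic C Y X"
  unfolding isomorphic_iff by blast

lemma comp_inverse:
  assumes "arr X Y f" "arr Y X f'" "arr Y Z g" "arr Z Y g'" "f' \<bullet>\<^bsub>C\<^esub> f = Idm C X" "g' \<bullet>\<^bsub>C\<^esub> g = Idm C Y"
  shows "(f' \<bullet>\<^bsub>C\<^esub> g') \<bullet>\<^bsub>C\<^esub> (g \<bullet>\<^bsub>C\<^esub> f) = Idm C X"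
proof -
  have "(f' \<bullet>\<^bsub>C\<^esub> g') \<bullet>\<^bsub>C\<^esub> (g \<bullet>\<^bsub>C\<^esub> f) = f' \<bullet>\<^bsub>C\<^esub> ((g' \<bullet>\<^bsub>C\<^esub> g) \<bullet>\<^bsub>C\<^esub> f)"
    using arr_assoc[OF arr_comp[OF assms(1,3)] assms(4,2)] arr_assoc[OF assms(1,3,4)] by simp
  then show ?thesis using assms by (simp add: id_comp)
qed

lemma isomorphic_trans:
  assumes "X \<in> Ob C" "Y \<in> Ob C" "Z \<in> Ob C" "isomorphic C X Y" "isomorphic C Y Z"
  shows "isomorphic C X Z"
proof -
  obtain f f' where f: "arr X Y f" "arr Y X f'" "f' \<bullet>\<^bsub>C\<^esub> f = Idm C X" "f \<bullet>\<^bsub>C\<^esub> f' = Idm C Y"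
    using assms isomorphic_iff by meson
  obtain g g' where g: "arr Y Z g" "arr Z Y g'" "g' \<bullet>\<^bsub>C\<^esub> g = Idm C Y" "g \<bullet>\<^bsub>C\<^esub> g' = Idm C Z"
    using assms isomorphic_iff by meson
  show ?thesis unfolding isomorphic_iff[OF assms(1,3)]
    using f g arr_comp[OF f(1) g(1)] arr_comp[OF g(2) f(2)]
      comp_inverse[OF f(1,2) g(1,2)] comp_inverse[OF g(2,1) f(2,1)] by blast
qed

lemma hom_trivial_iff:
  "X \<in> Ob C \<Longrightarrow> Y \<in> Ob C \<Longrightarrow> Mor C X Y = {zm X Y} \<longleftrightarrow> (\<forall>f. arr X Y f \<longrightarrow> f = zm X Y)"
  using arr_zero[of X Y] by (auto simp: arr_def)

text \<open>A map \<open>f\<close> from \<open>X'\<close> to \<open>Y'\<close> equals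
  \<open>q (j f p) i\<close>, and the bracket lies in a trivial Hom. Retracts are allowed in place
  of isomorphisms, so closure under direct summands follows as well.\<close>

lemma hom_trivial_retract:
  assumes "Mor C X Y = {zm X Y}" "arr X' X i" "arr X X' p" "p \<bullet>\<^bsub>C\<^esub> i = Idm C X'"
    and "arr Y' Y j" "arr Y Y' q" "q \<bullet>\<^bsub>C\<^esub> j = Idm C Y'"
  shows "Mor C X' Y' = {zm X' Y'}"
proof -
  have o: "X \<in> Ob C" "Y \<in> Ob C" "X' \<in> Ob C" "Y' \<in> Ob C" using assms by (auto simp: arr_def)
  have "f = zm X' Y'" if f: "arr X' Y' f" for f
  proof -
    have jf: "arr X' Y (j \<bullet>\<^bsub>C\<^esub> f)" using f assms arr_comp by blast
    have "(j \<bullet>\<^bsub>C\<^esub> f) \<bullet>\<^bsub>C\<^esub> p = zm X Y"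
      using arr_comp[OF assms(3) jf] assms(1) o by (simp add: hom_trivial_iff)
    then have "j \<bullet>\<^bsub>C\<^esub> f = zm X' Y"
      using arr_assoc[OF assms(2,3) jf] assms(4) comp_id[OF jf] zero_comp[OF assms(2) o(2)] by simp
    then show ?thesis
      using arr_assoc[OF f assms(5,6)] assms(7) id_comp[OF f] comp_zero[OF assms(6) o(3)] by simp
  qed
  then show ?thesis using o by (simp add: hom_trivial_iff)
qed

lemma hom_trivial_isomorphic:
  assumes "X \<in> Ob C" "X' \<in> Ob C" "Y \<in> Ob C" "Y' \<in> Ob C"
    and "isomorphic C X X'" "isomorphic C Y Y'" "Mor C X Y = {zm X Y}"
  shows "Mor C X' Y' = {zm X' Y'}"
proof -
  obtain p i where "arr X X' p" "arr X' X i" "p \<bullet>\<^bsub>C\<^esub> i = Idm C X'"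
    using assms isomorphic_iff by meson
  moreover obtain q j where "arr Y Y' q" "arr Y' Y j" "q \<bullet>\<^bsub>C\<^esub> j = Idm C Y'"
    using assms isomorphic_iff by meson
  ultimately show ?thesis using assms(7) hom_trivial_retract by blast
qed

subsection \<open>Equivalences\<close>

lemma
  assumes "endofunctor C F"
  shows fob_Ob: "X \<in> Ob C \<Longrightarrow> fob F X \<in> Ob C"
    and fmor_arr: "arr X Y f \<Longrightarrow> arr (fob F X) (fob F Y) (fmor F f)"
    and fmor_id: "X \<in> Ob C \<Longrightarrow> fmor F (Idm C X) = Idm C (fob F X)"
    and fmor_comp: "arr X Y f \<Longrightarrow> arr Y Z g \<Longrightarrow> fmor F (g \<bullet>\<^bsub>C\<^esub> f) = fmor F g \<bullet>\<^bsub>C\<^esub> fmor F f"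
  using assms unfolding endofunctor_def arr_def by blast+

lemma isomorphic_fob:
  assumes F: "endofunctor C F" and "X \<in> Ob C" "Y \<in> Ob C" "isomorphic C X Y"
  shows "isomorphic C (fob F X) (fob F Y)"
proof -
  obtain f g where fg: "arr X Y f" "arr Y X g" "g \<bullet>\<^bsub>C\<^esub> f = Idm C X" "f \<bullet>\<^bsub>C\<^esub> g = Idm C Y"
    using assms isomorphic_iff by meson
  then have "fmor F g \<bullet>\<^bsub>C\<^esub> fmor F f = Idm C (fob F X)" "fmor F f \<bullet>\<^bsub>C\<^esub> fmor F g = Idm C (fob F Y)"
    using assms(2,3) fmor_id[OF F] by (simp_all flip: fmor_comp[OF F])
  then show ?thesis
    using fmor_arr[OF F fg(1)] fmor_arr[OF F fg(2)] fob_Ob[OF F] assms(2,3) isomorphic_iff by blast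
qed

lemma endofunctor_id: "endofunctor C id_endo"
  by (simp add: endofunctor_def id_endo_def)

lemma endofunctor_comp: "endofunctor C F \<Longrightarrow> endofunctor C G \<Longrightarrow> endofunctor C (comp_endo F G)"
  unfolding endofunctor_def comp_endo_def by (simp, meson)

lemma comp_iso_id:
  assumes F: "endofunctor C F" and G: "endofunctor C G"
    and iso: "naturally_isomorphic C (comp_endo G F) id_endo"
  shows "\<exists>\<alpha> \<beta>. (\<forall>X\<in>Ob C. arr (fob G (fob F X)) X (\<alpha> X) \<and> arr X (fob G (fob F X)) (\<beta> X) \<and>
      \<beta> X \<bullet>\<^bsub>C\<^esub> \<alpha> X = Idm C (fob G (fob F X)) \<and> \<alpha> X \<bullet>\<^bsub>C\<^esub> \<beta> X = Idm C X) \<and>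
    (\<forall>X Y f. arr X Y f \<longrightarrow> \<alpha> Y \<bullet>\<^bsub>C\<^esub> fmor G (fmor F f) = f \<bullet>\<^bsub>C\<^esub> \<alpha> X)"
proof -
  obtain \<alpha> where iso: "\<forall>X\<in>Ob C. is_iso C (fob G (fob F X)) X (\<alpha> X)"
    and nat: "\<forall>X\<in>Ob C. \<forall>Y\<in>Ob C. \<forall>f\<in>Mor C X Y. \<alpha> Y \<bullet>\<^bsub>C\<^esub> fmor G (fmor F f) = f \<bullet>\<^bsub>C\<^esub> \<alpha> X"
    using iso by (auto simp: naturally_isomorphic_def comp_endo_def id_endo_def)
  have "\<forall>X\<in>Ob C. \<exists>g. arr (fob G (fob F X)) X (\<alpha> X) \<and> arr X (fob G (fob F X)) g \<and>
      g \<bullet>\<^bsub>C\<^esub> \<alpha> X = Idm C (fob G (fob F X)) \<and> \<alpha> X \<bullet>\<^bsub>C\<^esub> g = Idm C X"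
    using iso fob_Ob[OF G] fob_Ob[OF F] by (simp add: is_iso_iff)
  from bchoice[OF this] show ?thesis
    using nat by (auto simp: arr_def)
qed

text \<open>Conjugation by the natural isomorphism recovers \<open>f\<close> from
  \<open>fmor G (fmor F f)\<close>. The one-sided form also serves with \<open>F\<close> and
  \<open>G\<close> exchanged, where faithfulness of \<open>G\<close> yields fullness of
  \<open>F\<close>.\<close>

lemma faithful_of_left_inverse:
  assumes F: "endofunctor C F" and G: "endofunctor C G"
    and iso: "naturally_isomorphic C (comp_endo G F) id_endo"
    and f: "arr X Y f" "arr X Y f'" "fmor F f = fmor F f'"
  shows "f = f'"
proof -
  obtain \<alpha> \<beta> where ab: "\<forall>X\<in>Ob C. arr (fob G (fob F X)) X (\<alpha> X) \<and> arr X (fob G (fob F X)) (\<beta> X) \<and>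
      \<beta> X \<bullet>\<^bsub>C\<^esub> \<alpha> X = Idm C (fob G (fob F X)) \<and> \<alpha> X \<bullet>\<^bsub>C\<^esub> \<beta> X = Idm C X"
      and nat: "\<forall>X Y f. arr X Y f \<longrightarrow> \<alpha> Y \<bullet>\<^bsub>C\<^esub> fmor G (fmor F f) = f \<bullet>\<^bsub>C\<^esub> \<alpha> X"
    using comp_iso_id[OF F G iso] by (elim exE conjE)
  have \<alpha>: "arr (fob G (fob F X)) X (\<alpha> X)" "arr X (fob G (fob F X)) (\<beta> X)"
      "\<beta> X \<bullet>\<^bsub>C\<^esub> \<alpha> X = Idm C (fob G (fob F X))" "\<alpha> X \<bullet>\<^bsub>C\<^esub> \<beta> X = Idm C X" if "X \<in> Ob C" for X
    using ab that by auto
  have X: "X \<in> Ob C" using f arr_src by blast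
  have rec: "h = (\<alpha> Y \<bullet>\<^bsub>C\<^esub> fmor G (fmor F h)) \<bullet>\<^bsub>C\<^esub> \<beta> X" if h: "arr X Y h" for h
    using nat[rule_format, OF h] arr_assoc[OF \<alpha>(2)[OF X] \<alpha>(1)[OF X] h] \<alpha>(4)[OF X] comp_id[OF h] by simp
  show ?thesis using rec[OF f(1)] rec[OF f(2)] f(3) by metis
qed

lemma
  assumes "autoequivalence C F"
  shows autoequivalence_endofunctor: "endofunctor C F"
    and autoequivalence_faithful:
      "arr X Y f \<Longrightarrow> arr X Y f' \<Longrightarrow> fmor F f = fmor F f' \<Longrightarrow> f = f'"
    and autoequivalence_full:
      "X \<in> Ob C \<Longrightarrow> Y \<in> Ob C \<Longrightarrow> arr (fob F X) (fob F Y) h \<Longrightarrow> \<exists>f. arr X Y f \<and> fmor F f = h"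
    and autoequivalence_surj:
      "Y \<in> Ob C \<Longrightarrow> \<exists>X\<in>Ob C. isomorphic C (fob F X) Y"
proof -
  obtain G where F: "endofunctor C F" and G: "endofunctor C G"
    and GF: "naturally_isomorphic C (comp_endo G F) id_endo"
    and FG: "naturally_isomorphic C (comp_endo F G) id_endo"
    using assms by (auto simp: autoequivalence_def quasi_inverse_def)
  show "endofunctor C F" by (fact F)
  show "arr X Y f \<Longrightarrow> arr X Y f' \<Longrightarrow> fmor F f = fmor F f' \<Longrightarrow> f = f'"
    using faithful_of_left_inverse[OF F G GF] .
  show "\<exists>X\<in>Ob C. isomorphic C (fob F X) Y" if "Y \<in> Ob C"
    using FG that fob_Ob[OF G that]
    unfolding naturally_isomorphic_def isomorphic_def comp_endo_def id_endo_def by auto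
  obtain \<alpha> \<beta> where ab: "\<forall>X\<in>Ob C. arr (fob G (fob F X)) X (\<alpha> X) \<and> arr X (fob G (fob F X)) (\<beta> X) \<and>
      \<beta> X \<bullet>\<^bsub>C\<^esub> \<alpha> X = Idm C (fob G (fob F X)) \<and> \<alpha> X \<bullet>\<^bsub>C\<^esub> \<beta> X = Idm C X"
      and nat: "\<forall>X Y f. arr X Y f \<longrightarrow> \<alpha> Y \<bullet>\<^bsub>C\<^esub> fmor G (fmor F f) = f \<bullet>\<^bsub>C\<^esub> \<alpha> X"
    using comp_iso_id[OF F G GF] by (elim exE conjE)
  have \<alpha>: "arr (fob G (fob F X)) X (\<alpha> X)" "arr X (fob G (fob F X)) (\<beta> X)"
      "\<beta> X \<bullet>\<^bsub>C\<^esub> \<alpha> X = Idm C (fob G (fob F X))" "\<alpha> X \<bullet>\<^bsub>C\<^esub> \<beta> X = Idm C X" if "X \<in> Ob C" for X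
    using ab that by auto
  assume X: "X \<in> Ob C" and Y: "Y \<in> Ob C" and h: "arr (fob F X) (fob F Y) h"
  have Gh: "arr (fob G (fob F X)) (fob G (fob F Y)) (fmor G h)" using fmor_arr[OF G h] .
  note \<alpha>Gh = arr_comp[OF Gh \<alpha>(1)[OF Y]]
  \<comment> \<open>The candidate preimage of \<open>h\<close> is \<open>fmor G h\<close>,
    conjugated into a map from \<open>X\<close> to \<open>Y\<close>. Naturality gives
    \<open>fmor G (fmor F f) = fmor G h\<close>, and faithfulness of \<open>G\<close> removes
    \<open>fmor G\<close>.\<close>
  define f where "f = (\<alpha> Y \<bullet>\<^bsub>C\<^esub> fmor G h) \<bullet>\<^bsub>C\<^esub> \<beta> X"
  have f: "arr X Y f" unfolding f_def using arr_comp[OF \<alpha>(2)[OF X] \<alpha>Gh] .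
  have GFf: "arr (fob G (fob F X)) (fob G (fob F Y)) (fmor G (fmor F f))"
    using fmor_arr[OF G fmor_arr[OF F f]] .
  have cancel: "k = \<beta> Y \<bullet>\<^bsub>C\<^esub> (\<alpha> Y \<bullet>\<^bsub>C\<^esub> k)" if k: "arr (fob G (fob F X)) (fob G (fob F Y)) k" for k
    using arr_assoc[OF k \<alpha>(1,2)[OF Y]] \<alpha>(3)[OF Y] id_comp[OF k] by simp
  have "\<alpha> Y \<bullet>\<^bsub>C\<^esub> fmor G (fmor F f) = f \<bullet>\<^bsub>C\<^esub> \<alpha> X" using nat[rule_format, OF f] .
  also have "\<dots> = \<alpha> Y \<bullet>\<^bsub>C\<^esub> fmor G h"
    unfolding f_def using arr_assoc[OF \<alpha>(1)[OF X] \<alpha>(2)[OF X] \<alpha>Gh] \<alpha>(3)[OF X] comp_id[OF \<alpha>Gh] by simp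
  finally have "fmor G (fmor F f) = fmor G h" using cancel[OF GFf] cancel[OF Gh] by simp
  then have "fmor F f = h" using faithful_of_left_inverse[OF G F FG fmor_arr[OF F f] h] by simp
  with f show "\<exists>f. arr X Y f \<and> fmor F f = h" by blast
qed

lemma hom_trivial_autoequivalence:
  assumes F: "autoequivalence C F" and o: "X \<in> Ob C" "Y \<in> Ob C"
  shows "Mor C (fob F X) (fob F Y) = {zm (fob F X) (fob F Y)} \<longleftrightarrow> Mor C X Y = {zm X Y}"
proof -
  note E = autoequivalence_endofunctor[OF F]
  have Fo: "fob F X \<in> Ob C" "fob F Y \<in> Ob C" using fob_Ob[OF E] o by auto
  show ?thesis unfolding hom_trivial_iff[OF o] hom_trivial_iff[OF Fo]
  proof safe
    fix f assume "\<forall>f. arr (fob F X) (fob F Y) f \<longrightarrow> f = zm (fob F X) (fob F Y)" "arr X Y f"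
    then show "f = zm X Y"
      using autoequivalence_faithful[OF F] fmor_arr[OF E] arr_zero[OF o] by metis
  next
    fix h assume "\<forall>f. arr X Y f \<longrightarrow> f = zm X Y" "arr (fob F X) (fob F Y) h"
    then show "h = zm (fob F X) (fob F Y)"
      using autoequivalence_full[OF F o] arr_zero[OF Fo] by metis
  qed
qed

lemma isomorphic_reflect:
  assumes F: "autoequivalence C F" and o: "X \<in> Ob C" "Y \<in> Ob C"
    and iso: "isomorphic C (fob F X) (fob F Y)"
  shows "isomorphic C X Y"
proof -
  note E = autoequivalence_endofunctor[OF F]
  have Fo: "fob F X \<in> Ob C" "fob F Y \<in> Ob C" using fob_Ob[OF E] o by auto
  obtain h k where hk: "arr (fob F X) (fob F Y) h" "arr (fob F Y) (fob F X) k"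
      "k \<bullet>\<^bsub>C\<^esub> h = Idm C (fob F X)" "h \<bullet>\<^bsub>C\<^esub> k = Idm C (fob F Y)"
    using iso Fo by (auto simp: isomorphic_iff)
  obtain f g where fg: "arr X Y f" "fmor F f = h" "arr Y X g" "fmor F g = k"
    using autoequivalence_full[OF F] o hk by metis
  have "fmor F (g \<bullet>\<^bsub>C\<^esub> f) = fmor F (Idm C X)" "fmor F (f \<bullet>\<^bsub>C\<^esub> g) = fmor F (Idm C Y)"
    using fg hk o fmor_comp[OF E] fmor_id[OF E] by simp_all
  then have "g \<bullet>\<^bsub>C\<^esub> f = Idm C X" "f \<bullet>\<^bsub>C\<^esub> g = Idm C Y"
    using autoequivalence_faithful[OF F] fg o arr_comp arr_Idm by metis+
  then show ?thesis using fg o isomorphic_iff by blast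
qed

lemma minus_zero:
  assumes "arr X Y f" shows "f \<ominus>\<^bsub>Hom C X Y\<^esub> zm X Y = f"
proof -
  interpret H: abelian_group "Hom C X Y" using assms Hom_group by (auto simp: arr_def)
  have "\<ominus>\<^bsub>Hom C X Y\<^esub> zm X Y = zm X Y" by (rule H.minus_equality) auto
  then show ?thesis using assms by (simp add: arr_def a_minus_def)
qed

lemma add_minus_cancel:
  assumes "arr X Y f" "arr X Y g" shows "f \<oplus>\<^bsub>Hom C X Y\<^esub> (g \<ominus>\<^bsub>Hom C X Y\<^esub> f) = g"
proof -
  interpret H: abelian_group "Hom C X Y" using assms Hom_group by (auto simp: arr_def)
  have "f \<in> Mor C X Y" "g \<in> Mor C X Y" using assms by (auto simp: arr_def)
  then show ?thesis by (metis H.a_lcomm H.a_inv_closed H.r_neg H.r_zero a_minus_def)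
qed

lemma neg_zero:
  assumes "X \<in> Ob C" "Y \<in> Ob C" shows "\<ominus>\<^bsub>Hom C X Y\<^esub> zm X Y = zm X Y"
proof -
  interpret H: abelian_group "Hom C X Y" using assms Hom_group by auto
  show ?thesis by (rule H.minus_equality) auto
qed

lemma neg_eq_zero_iff: "arr X Y f \<Longrightarrow> \<ominus>\<^bsub>Hom C X Y\<^esub> f = zm X Y \<longleftrightarrow> f = zm X Y"
  using neg_neg neg_zero arr_src arr_tgt by metis

subsection \<open>Retracts and approximations\<close>

lemma idempotents_split_onE:
  assumes "idempotents_split_on C \<U>" "U \<in> \<U>" "arr U U e" "e \<bullet>\<^bsub>C\<^esub> e = e"
  obtains Y p i where "arr U Y p" "arr Y U i" "p \<bullet>\<^bsub>C\<^esub> i = Idm C Y" "i \<bullet>\<^bsub>C\<^esub> p = e"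
  using assms unfolding idempotents_split_on_def arr_def by metis

text \<open>The complement of \<open>X\<close> is the image of the idempotent \<open>1 - i p\<close>
  of \<open>W\<close>, which exists because idempotents of \<open>W\<close> split. This connects
  retracts with thickness, which speaks of direct sums.\<close>

lemma retract_direct_summand:
  assumes split: "idempotents_split_on C \<U>" and W: "W \<in> \<U>"
    and i: "arr X W i" and p: "arr W X p" and pi: "p \<bullet>\<^bsub>C\<^esub> i = Idm C X"
  shows "\<exists>Y. direct_sum C X Y W"
proof -
  have ip: "arr W W (i \<bullet>\<^bsub>C\<^esub> p)" using arr_comp[OF p i] .
  have id: "arr W W (Idm C W)" using arr_Idm arr_tgt[OF i] by blast
  have o: "X \<in> Ob C" "W \<in> Ob C" using i by (auto simp: arr_def)
  define e where "e = Idm C W \<ominus>\<^bsub>Hom C W W\<^esub> (i \<bullet>\<^bsub>C\<^esub> p)"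
  have e: "arr W W e" unfolding e_def using arr_minus[OF id ip] .
  have "(i \<bullet>\<^bsub>C\<^esub> p) \<bullet>\<^bsub>C\<^esub> i = i" using arr_assoc[OF i p i] pi comp_id[OF i] by simp
  then have ei: "e \<bullet>\<^bsub>C\<^esub> i = zm X W"
    unfolding e_def using i by (simp add: minus_comp[OF i id ip] id_comp minus_zero_iff)
  have "p \<bullet>\<^bsub>C\<^esub> (i \<bullet>\<^bsub>C\<^esub> p) = p" using arr_assoc[OF p i p] pi id_comp[OF p] by simp
  then have pe: "p \<bullet>\<^bsub>C\<^esub> e = zm W X"
    unfolding e_def using p by (simp add: comp_minus[OF p id ip] comp_id minus_zero_iff)
  have eip: "e \<bullet>\<^bsub>C\<^esub> (i \<bullet>\<^bsub>C\<^esub> p) = zm W W"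
    using arr_assoc[OF p i e] ei zero_comp[OF p o(2)] by simp
  have "e \<bullet>\<^bsub>C\<^esub> e = e \<bullet>\<^bsub>C\<^esub> Idm C W \<ominus>\<^bsub>Hom C W W\<^esub> e \<bullet>\<^bsub>C\<^esub> (i \<bullet>\<^bsub>C\<^esub> p)"
    by (subst (2) e_def) (rule comp_minus[OF e id ip])
  then have "e \<bullet>\<^bsub>C\<^esub> e = e" using eip minus_zero[OF e] comp_id[OF e] by simp
  then obtain Y q j where q: "arr W Y q" and j: "arr Y W j"
    and qj: "q \<bullet>\<^bsub>C\<^esub> j = Idm C Y" and jq: "j \<bullet>\<^bsub>C\<^esub> q = e"
    using idempotents_split_onE[OF split W e] by metis
  \<comment> \<open>Since \<open>j = j q j = e j\<close>, the composite \<open>p j\<close> factors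
    through \<open>p e = 0\<close>. In the same way \<open>q i\<close> below factors through
    \<open>e i = 0\<close>.\<close>
  have "p \<bullet>\<^bsub>C\<^esub> j = (p \<bullet>\<^bsub>C\<^esub> e) \<bullet>\<^bsub>C\<^esub> j"
    using arr_assoc[OF j e p] arr_assoc[OF j q j] comp_id[OF j] by (simp add: jq qj)
  then have pj: "p \<bullet>\<^bsub>C\<^esub> j = zm Y X" using pe zero_comp[OF j o(1)] by simp
  have "q \<bullet>\<^bsub>C\<^esub> i = q \<bullet>\<^bsub>C\<^esub> (e \<bullet>\<^bsub>C\<^esub> i)"
    using arr_assoc[OF arr_comp[OF i q] j q] arr_assoc[OF i q j] id_comp[OF arr_comp[OF i q]]
    by (simp add: qj flip: jq)
  then have qi: "q \<bullet>\<^bsub>C\<^esub> i = zm X Y" using ei comp_zero[OF q o(1)] by simp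
  have "(i \<bullet>\<^bsub>C\<^esub> p) \<oplus>\<^bsub>Hom C W W\<^esub> (j \<bullet>\<^bsub>C\<^esub> q) = Idm C W"
    unfolding jq e_def by (rule add_minus_cancel[OF ip id])
  then show ?thesis
    unfolding direct_sum_def using i j p q pi qj pj qi unfolding arr_def by metis
qed

text \<open>
  A weak cokernel \<open>c\<close> of the relations on an approximation \<open>f\<close> represents a functor of which
  \<open>Hom(-, X)\<close> restricted to \<open>\<U>\<close> is a retract; splitting the resulting idempotent \<open>c s\<close> yields
  a representing object of the latter.
\<close>

lemma coreflection_of_splitting:
  assumes split: "idempotents_split_on C \<U>" and U: "U \<in> \<U>" "V \<in> \<U>"
    and f: "arr U X f" and c: "arr U V c" and g: "arr V X g" and s: "arr V U s"
    and gc: "g \<bullet>\<^bsub>C\<^esub> c = f" and fs: "f \<bullet>\<^bsub>C\<^esub> s = g"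
    and approx: "\<And>W h. W \<in> \<U> \<Longrightarrow> arr W X h \<Longrightarrow> \<exists>t. arr W U t \<and> f \<bullet>\<^bsub>C\<^esub> t = h"
    and kill: "\<And>W w. W \<in> \<U> \<Longrightarrow> arr W U w \<Longrightarrow> f \<bullet>\<^bsub>C\<^esub> w = zm W X \<Longrightarrow> c \<bullet>\<^bsub>C\<^esub> w = zm W V"
  shows "\<exists>Y i p r. arr Y V i \<and> arr V Y p \<and> p \<bullet>\<^bsub>C\<^esub> i = Idm C Y \<and> arr Y X r \<and>
    (\<forall>W\<in>\<U>. \<forall>h. arr W X h \<longrightarrow> (\<exists>t. arr W Y t \<and> r \<bullet>\<^bsub>C\<^esub> t = h)) \<and>
    (\<forall>W\<in>\<U>. \<forall>t. arr W Y t \<and> r \<bullet>\<^bsub>C\<^esub> t = zm W X \<longrightarrow> t = zm W Y)"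
proof -
  have o: "U \<in> Ob C" "V \<in> Ob C" using c by (auto simp: arr_def)
  define e where "e = c \<bullet>\<^bsub>C\<^esub> s"
  have e: "arr V V e" unfolding e_def using arr_comp[OF s c] .
  have sc: "arr U U (s \<bullet>\<^bsub>C\<^esub> c)" using arr_comp[OF c s] .
  \<comment> \<open>The maps \<open>s c\<close> and the identity agree after \<open>f\<close>, hence
    after \<open>c\<close> by \<open>kill\<close>. The resulting \<open>c s c = c\<close> makes
    \<open>c s\<close> idempotent.\<close>
  have "f \<bullet>\<^bsub>C\<^esub> (s \<bullet>\<^bsub>C\<^esub> c) = f \<bullet>\<^bsub>C\<^esub> Idm C U"
    using arr_assoc[OF c s f] fs gc comp_id[OF f] by simp
  then have csc: "c \<bullet>\<^bsub>C\<^esub> (s \<bullet>\<^bsub>C\<^esub> c) = c"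
    using comp_cancel_of_zero[OF f c sc arr_Idm[OF o(1)]] kill[OF U(1)] comp_id[OF c] by simp
  have "e \<bullet>\<^bsub>C\<^esub> e = (c \<bullet>\<^bsub>C\<^esub> (s \<bullet>\<^bsub>C\<^esub> c)) \<bullet>\<^bsub>C\<^esub> s"
    unfolding e_def using arr_assoc[OF arr_comp[OF s c] s c] arr_assoc[OF s c s] arr_assoc[OF s sc c] by simp
  then have "e \<bullet>\<^bsub>C\<^esub> e = e" using csc by (simp add: e_def)
  then obtain Y p i where p: "arr V Y p" and i: "arr Y V i"
    and pi: "p \<bullet>\<^bsub>C\<^esub> i = Idm C Y" and ip: "i \<bullet>\<^bsub>C\<^esub> p = e"
    using idempotents_split_onE[OF split U(2) e] by metis
  have ge: "g \<bullet>\<^bsub>C\<^esub> e = g" unfolding e_def using arr_assoc[OF s c g] gc fs by simp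
  have ei: "e \<bullet>\<^bsub>C\<^esub> i = i" using arr_assoc[OF i p i] pi ip comp_id[OF i] by simp
  define r where "r = g \<bullet>\<^bsub>C\<^esub> i"
  have r: "arr Y X r" unfolding r_def using arr_comp[OF i g] .
  have rp: "r \<bullet>\<^bsub>C\<^esub> p = g" unfolding r_def using arr_assoc[OF p i g] ip ge by simp
  have "\<exists>t. arr W Y t \<and> r \<bullet>\<^bsub>C\<^esub> t = h" if W: "W \<in> \<U>" and h: "arr W X h" for W h
  proof -
    obtain t where t: "arr W U t" "f \<bullet>\<^bsub>C\<^esub> t = h" using approx[OF W h] by blast
    have ct: "arr W V (c \<bullet>\<^bsub>C\<^esub> t)" using arr_comp[OF t(1) c] .
    have "r \<bullet>\<^bsub>C\<^esub> (p \<bullet>\<^bsub>C\<^esub> (c \<bullet>\<^bsub>C\<^esub> t)) = h"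
      using arr_assoc[OF ct p r] rp arr_assoc[OF t(1) c g] gc t(2) by simp
    then show ?thesis using arr_comp[OF ct p] by blast
  qed
  moreover have "t = zm W Y" if W: "W \<in> \<U>" and t: "arr W Y t" and rt: "r \<bullet>\<^bsub>C\<^esub> t = zm W X" for W t
  proof -
    have it: "arr W V (i \<bullet>\<^bsub>C\<^esub> t)" using arr_comp[OF t i] .
    have Wo: "W \<in> Ob C" using arr_src[OF t] .
    \<comment> \<open>From \<open>f s = g\<close> one gets \<open>f (s (i t)) = r t = 0\<close>.
      Then \<open>kill\<close> annihilates \<open>c (s (i t)) = e (i t) = i t\<close>, and
      \<open>i\<close> is a split monomorphism.\<close>
    have "f \<bullet>\<^bsub>C\<^esub> (s \<bullet>\<^bsub>C\<^esub> (i \<bullet>\<^bsub>C\<^esub> t)) = zm W X"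
      using arr_assoc[OF it s f] fs arr_assoc[OF t i g] rt by (simp add: r_def)
    then have "c \<bullet>\<^bsub>C\<^esub> (s \<bullet>\<^bsub>C\<^esub> (i \<bullet>\<^bsub>C\<^esub> t)) = zm W V" using kill[OF W arr_comp[OF it s]] by simp
    then have "i \<bullet>\<^bsub>C\<^esub> t = zm W V"
      using arr_assoc[OF it s c] arr_assoc[OF t i e] ei by (simp flip: e_def)
    then show ?thesis
      using arr_assoc[OF t i p] pi id_comp[OF t] comp_zero[OF p Wo] by simp
  qed
  ultimately show ?thesis using p i pi r by blast
qed

text \<open>The preceding argument with all arrows reversed: \<open>c\<close> now points from
  \<open>V\<close> to \<open>U\<close>, and the idempotent of \<open>V\<close> is
  \<open>s c\<close>.\<close>

lemma reflection_of_splitting: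
  assumes split: "idempotents_split_on C \<U>" and U: "U \<in> \<U>" "V \<in> \<U>"
    and f: "arr X U f" and c: "arr V U c" and g: "arr X V g" and s: "arr U V s"
    and cg: "c \<bullet>\<^bsub>C\<^esub> g = f" and sf: "s \<bullet>\<^bsub>C\<^esub> f = g"
    and approx: "\<And>W h. W \<in> \<U> \<Longrightarrow> arr X W h \<Longrightarrow> \<exists>t. arr U W t \<and> t \<bullet>\<^bsub>C\<^esub> f = h"
    and kill: "\<And>W w. W \<in> \<U> \<Longrightarrow> arr U W w \<Longrightarrow> w \<bullet>\<^bsub>C\<^esub> f = zm X W \<Longrightarrow> w \<bullet>\<^bsub>C\<^esub> c = zm V W"
  shows "\<exists>Y i p r. arr Y V i \<and> arr V Y p \<and> p \<bullet>\<^bsub>C\<^esub> i = Idm C Y \<and> arr X Y r \<and>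
    (\<forall>W\<in>\<U>. \<forall>h. arr X W h \<longrightarrow> (\<exists>t. arr Y W t \<and> t \<bullet>\<^bsub>C\<^esub> r = h)) \<and>
    (\<forall>W\<in>\<U>. \<forall>t. arr Y W t \<and> t \<bullet>\<^bsub>C\<^esub> r = zm X W \<longrightarrow> t = zm Y W)"
proof -
  have o: "U \<in> Ob C" "V \<in> Ob C" using c by (auto simp: arr_def)
  define e where "e = s \<bullet>\<^bsub>C\<^esub> c"
  have e: "arr V V e" unfolding e_def using arr_comp[OF c s] .
  have cs: "arr U U (c \<bullet>\<^bsub>C\<^esub> s)" using arr_comp[OF s c] .
  have "(c \<bullet>\<^bsub>C\<^esub> s) \<bullet>\<^bsub>C\<^esub> f = Idm C U \<bullet>\<^bsub>C\<^esub> f"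
    using arr_assoc[OF f s c] sf cg id_comp[OF f] by simp
  then have csc: "(c \<bullet>\<^bsub>C\<^esub> s) \<bullet>\<^bsub>C\<^esub> c = c"
    using cancel_comp_of_zero[OF f c cs arr_Idm[OF o(1)]] kill[OF U(1)] id_comp[OF c] by simp
  have "e \<bullet>\<^bsub>C\<^esub> e = s \<bullet>\<^bsub>C\<^esub> ((c \<bullet>\<^bsub>C\<^esub> s) \<bullet>\<^bsub>C\<^esub> c)"
    unfolding e_def using arr_assoc[OF arr_comp[OF c s] c s] arr_assoc[OF c s c] by simp
  then have "e \<bullet>\<^bsub>C\<^esub> e = e" using csc by (simp add: e_def)
  then obtain Y p i where p: "arr V Y p" and i: "arr Y V i"
    and pi: "p \<bullet>\<^bsub>C\<^esub> i = Idm C Y" and ip: "i \<bullet>\<^bsub>C\<^esub> p = e"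
    using idempotents_split_onE[OF split U(2) e] by metis
  have eg: "e \<bullet>\<^bsub>C\<^esub> g = g" unfolding e_def using arr_assoc[OF g c s] cg sf by simp
  have pe: "p \<bullet>\<^bsub>C\<^esub> e = p" using arr_assoc[OF p i p] pi ip id_comp[OF p] by simp
  define r where "r = p \<bullet>\<^bsub>C\<^esub> g"
  have r: "arr X Y r" unfolding r_def using arr_comp[OF g p] .
  have ir: "i \<bullet>\<^bsub>C\<^esub> r = g" unfolding r_def using arr_assoc[OF g p i] ip eg by simp
  have "\<exists>t. arr Y W t \<and> t \<bullet>\<^bsub>C\<^esub> r = h" if W: "W \<in> \<U>" and h: "arr X W h" for W h
  proof -
    obtain t where t: "arr U W t" "t \<bullet>\<^bsub>C\<^esub> f = h" using approx[OF W h] by blast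
    have tc: "arr V W (t \<bullet>\<^bsub>C\<^esub> c)" using arr_comp[OF c t(1)] .
    have "((t \<bullet>\<^bsub>C\<^esub> c) \<bullet>\<^bsub>C\<^esub> i) \<bullet>\<^bsub>C\<^esub> r = h"
      using arr_assoc[OF r i tc] ir arr_assoc[OF g c t(1)] cg t(2) by simp
    then show ?thesis using arr_comp[OF i tc] by blast
  qed
  moreover have "t = zm Y W" if W: "W \<in> \<U>" and t: "arr Y W t" and tr: "t \<bullet>\<^bsub>C\<^esub> r = zm X W" for W t
  proof -
    have tp: "arr V W (t \<bullet>\<^bsub>C\<^esub> p)" using arr_comp[OF p t] .
    have Wo: "W \<in> Ob C" using arr_tgt[OF t] .
    have "((t \<bullet>\<^bsub>C\<^esub> p) \<bullet>\<^bsub>C\<^esub> s) \<bullet>\<^bsub>C\<^esub> f = zm X W"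
      using arr_assoc[OF f s tp] sf arr_assoc[OF g p t] tr by (simp add: r_def)
    then have "((t \<bullet>\<^bsub>C\<^esub> p) \<bullet>\<^bsub>C\<^esub> s) \<bullet>\<^bsub>C\<^esub> c = zm V W" using kill[OF W arr_comp[OF s tp]] by simp
    then have "t \<bullet>\<^bsub>C\<^esub> p = zm V W"
      using arr_assoc[OF c s tp] arr_assoc[OF e p t] pe by (simp flip: e_def)
    then show ?thesis
      using arr_assoc[OF i p t] pi comp_id[OF t] zero_comp[OF i Wo] by simp
  qed
  ultimately show ?thesis using p i pi r by blast
qed

lemma right_approximation_iff:
  assumes "\<U> \<subseteq> Ob C" "X \<in> Ob C"
  shows "right_approximation C \<U> W X f \<longleftrightarrow>
    W \<in> \<U> \<and> arr W X f \<and> (\<forall>V\<in>\<U>. \<forall>h. arr V X h \<longrightarrow> (\<exists>t. arr V W t \<and> f \<bullet>\<^bsub>C\<^esub> t = h))"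
proof -
  have "(\<lambda>u. f \<bullet>\<^bsub>C\<^esub> u) ` Mor C V W = Mor C V X \<longleftrightarrow> (\<forall>h. arr V X h \<longrightarrow> (\<exists>t. arr V W t \<and> f \<bullet>\<^bsub>C\<^esub> t = h))"
    if "V \<in> \<U>" "W \<in> \<U>" "f \<in> Mor C W X" for V
  proof -
    have o: "V \<in> Ob C" "W \<in> Ob C" using that assms by auto
    then have sub: "(\<lambda>u. f \<bullet>\<^bsub>C\<^esub> u) ` Mor C V W \<subseteq> Mor C V X"
      using that assms arr_comp[of V W _ X f] by (auto simp: arr_def)
    have "(\<lambda>u. f \<bullet>\<^bsub>C\<^esub> u) ` Mor C V W = Mor C V X \<longleftrightarrow> Mor C V X \<subseteq> (\<lambda>u. f \<bullet>\<^bsub>C\<^esub> u) ` Mor C V W"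
      using sub by blast
    also have "\<dots> \<longleftrightarrow> (\<forall>h\<in>Mor C V X. \<exists>t\<in>Mor C V W. f \<bullet>\<^bsub>C\<^esub> t = h)" by auto
    finally show ?thesis using o assms(2) by (simp add: arr_def Ball_def Bex_def)
  qed
  then have "(\<forall>V\<in>\<U>. (\<lambda>u. f \<bullet>\<^bsub>C\<^esub> u) ` Mor C V W = Mor C V X) \<longleftrightarrow> (\<forall>V\<in>\<U>. \<forall>h. arr V X h \<longrightarrow> (\<exists>t. arr V W t \<and> f \<bullet>\<^bsub>C\<^esub> t = h))"
    if "W \<in> \<U>" "f \<in> Mor C W X"
    using that by (intro ball_cong) auto
  moreover have "arr W X f \<longleftrightarrow> f \<in> Mor C W X" if "W \<in> \<U>"
    using that assms by (auto simp: arr_def)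
  ultimately show ?thesis unfolding right_approximation_def by blast
qed

lemma left_approximation_iff:
  assumes "\<U> \<subseteq> Ob C" "X \<in> Ob C"
  shows "left_approximation C \<U> X W f \<longleftrightarrow>
    W \<in> \<U> \<and> arr X W f \<and> (\<forall>V\<in>\<U>. \<forall>h. arr X V h \<longrightarrow> (\<exists>t. arr W V t \<and> t \<bullet>\<^bsub>C\<^esub> f = h))"
proof -
  have "(\<lambda>u. u \<bullet>\<^bsub>C\<^esub> f) ` Mor C W V = Mor C X V \<longleftrightarrow> (\<forall>h. arr X V h \<longrightarrow> (\<exists>t. arr W V t \<and> t \<bullet>\<^bsub>C\<^esub> f = h))"
    if "V \<in> \<U>" "W \<in> \<U>" "f \<in> Mor C X W" for V
  proof -
    have o: "V \<in> Ob C" "W \<in> Ob C" using that assms by auto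
    then have sub: "(\<lambda>u. u \<bullet>\<^bsub>C\<^esub> f) ` Mor C W V \<subseteq> Mor C X V"
      using that assms arr_comp[of X W f V] by (auto simp: arr_def)
    have "(\<lambda>u. u \<bullet>\<^bsub>C\<^esub> f) ` Mor C W V = Mor C X V \<longleftrightarrow> Mor C X V \<subseteq> (\<lambda>u. u \<bullet>\<^bsub>C\<^esub> f) ` Mor C W V"
      using sub by blast
    also have "\<dots> \<longleftrightarrow> (\<forall>h\<in>Mor C X V. \<exists>t\<in>Mor C W V. t \<bullet>\<^bsub>C\<^esub> f = h)" by auto
    finally show ?thesis using o assms(2) by (simp add: arr_def Ball_def Bex_def)
  qed
  then have "(\<forall>V\<in>\<U>. (\<lambda>u. u \<bullet>\<^bsub>C\<^esub> f) ` Mor C W V = Mor C X V) \<longleftrightarrow> (\<forall>V\<in>\<U>. \<forall>h. arr X V h \<longrightarrow> (\<exists>t. arr W V t \<and> t \<bullet>\<^bsub>C\<^esub> f = h))"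
    if "W \<in> \<U>" "f \<in> Mor C X W"
    using that by (intro ball_cong) auto
  moreover have "arr X W f \<longleftrightarrow> f \<in> Mor C X W" if "W \<in> \<U>"
    using that assms by (auto simp: arr_def)
  ultimately show ?thesis unfolding left_approximation_def by blast
qed

subsection \<open>Transport along autoequivalences\<close>

lemma essential_imageE:
  assumes "endofunctor C F" "\<U> \<subseteq> Ob C" "V \<in> essential_image C F \<U>"
  obtains U a b where "U \<in> \<U>" "arr (fob F U) V a" "arr V (fob F U) b"
    "b \<bullet>\<^bsub>C\<^esub> a = Idm C (fob F U)" "a \<bullet>\<^bsub>C\<^esub> b = Idm C V"
proof -
  obtain U where U: "U \<in> \<U>" "V \<in> Ob C" "isomorphic C (fob F U) V"
    using assms(3) by (auto simp: essential_image_def)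
  then have "fob F U \<in> Ob C" using assms fob_Ob by blast
  then show thesis using U that isomorphic_iff by metis
qed

lemma autoequivalence_surjE:
  assumes "autoequivalence C F" "X \<in> Ob C"
  obtains U a b where "U \<in> Ob C" "arr (fob F U) X a" "arr X (fob F U) b"
    "b \<bullet>\<^bsub>C\<^esub> a = Idm C (fob F U)" "a \<bullet>\<^bsub>C\<^esub> b = Idm C X"
  using autoequivalence_surj[OF assms] assms(2)
    essential_imageE[OF autoequivalence_endofunctor[OF assms(1)] subset_refl, of X]
  by (auto simp: essential_image_def)

lemma fob_essential_image:
  "endofunctor C F \<Longrightarrow> \<U> \<subseteq> Ob C \<Longrightarrow> U \<in> \<U> \<Longrightarrow> fob F U \<in> essential_image C F \<U>"
  unfolding essential_image_def using fob_Ob isomorphic_refl by blast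

text \<open>Fullness lifts a map \<open>h\<close> between objects isomorphic to values of
  \<open>F\<close> only after conjugation by the isomorphisms; this undoes the conjugation, in the
  bracketing that arises for approximations.\<close>

lemma conj_inverse_cancel:
  assumes "arr X X' a" "arr X' X b" "b \<bullet>\<^bsub>C\<^esub> a = Idm C X" "arr Y Y' c" "arr Y' Y d" "d \<bullet>\<^bsub>C\<^esub> c = Idm C Y"
    and h: "arr X Y h"
  shows "d \<bullet>\<^bsub>C\<^esub> ((c \<bullet>\<^bsub>C\<^esub> (h \<bullet>\<^bsub>C\<^esub> b)) \<bullet>\<^bsub>C\<^esub> a) = h"
proof -
  have hb: "arr X' Y (h \<bullet>\<^bsub>C\<^esub> b)" using arr_comp[OF assms(2) h] .
  have "(h \<bullet>\<^bsub>C\<^esub> b) \<bullet>\<^bsub>C\<^esub> a = h" using arr_assoc[OF assms(1,2) h] assms(3) comp_id[OF h] by simp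
  then show ?thesis
    using arr_assoc[OF assms(1) hb assms(4)] arr_assoc[OF h assms(4,5)] assms(6) id_comp[OF h] by simp
qed

text \<open>For \<open>V\<close> isomorphic to \<open>F U\<close>, fullness lifts the conjugate of
  \<open>e\<close> to an endomorphism \<open>e'\<close> of \<open>U\<close>, and faithfulness makes
  \<open>e'\<close> idempotent. Applying \<open>F\<close> to a splitting of \<open>e'\<close> and
  conjugating back splits \<open>e\<close>.\<close>

lemma idempotents_split_on_essential_image:
  assumes F: "autoequivalence C F" and sub: "\<U> \<subseteq> Ob C" and split: "idempotents_split_on C \<U>"
  shows "idempotents_split_on C (essential_image C F \<U>)"
  unfolding idempotents_split_on_def
proof (intro ballI impI)
  fix V e assume V: "V \<in> essential_image C F \<U>" and e0: "e \<in> Mor C V V" and ee: "e \<bullet>\<^bsub>C\<^esub> e = e"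
  note E = autoequivalence_endofunctor[OF F]
  obtain U a b where U: "U \<in> \<U>" and a: "arr (fob F U) V a" and b: "arr V (fob F U) b"
    and ba: "b \<bullet>\<^bsub>C\<^esub> a = Idm C (fob F U)" and ab: "a \<bullet>\<^bsub>C\<^esub> b = Idm C V"
    using essential_imageE[OF E sub V] by metis
  have Uo: "U \<in> Ob C" using U sub by blast
  have e: "arr V V e" using e0 arr_tgt[OF a] by (simp add: arr_def)
  have ea: "arr (fob F U) V (e \<bullet>\<^bsub>C\<^esub> a)" using arr_comp[OF a e] .
  obtain e' where e': "arr U U e'" and Fe': "fmor F e' = b \<bullet>\<^bsub>C\<^esub> (e \<bullet>\<^bsub>C\<^esub> a)"
    using autoequivalence_full[OF F Uo Uo arr_comp[OF ea b]] by blast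
  have aFe': "a \<bullet>\<^bsub>C\<^esub> fmor F e' = e \<bullet>\<^bsub>C\<^esub> a"
    using Fe' arr_assoc[OF ea b a] ab id_comp[OF ea] by simp
  have Fe'a: "arr (fob F U) (fob F U) (fmor F e')" using fmor_arr[OF E e'] .
  have "fmor F (e' \<bullet>\<^bsub>C\<^esub> e') = b \<bullet>\<^bsub>C\<^esub> ((e \<bullet>\<^bsub>C\<^esub> a) \<bullet>\<^bsub>C\<^esub> fmor F e')"
    using fmor_comp[OF E e' e'] arr_assoc[OF Fe'a ea b] Fe' by simp
  also have "(e \<bullet>\<^bsub>C\<^esub> a) \<bullet>\<^bsub>C\<^esub> fmor F e' = e \<bullet>\<^bsub>C\<^esub> a"
    using arr_assoc[OF Fe'a a e] aFe' arr_assoc[OF a e e] ee by simp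
  finally have "fmor F (e' \<bullet>\<^bsub>C\<^esub> e') = fmor F e'" using Fe' by simp
  then have "e' \<bullet>\<^bsub>C\<^esub> e' = e'" using autoequivalence_faithful[OF F arr_comp[OF e' e'] e'] by simp
  then obtain Y p i where p: "arr U Y p" and i: "arr Y U i"
    and pi: "p \<bullet>\<^bsub>C\<^esub> i = Idm C Y" and ip: "i \<bullet>\<^bsub>C\<^esub> p = e'"
    using idempotents_split_onE[OF split U e'] by metis
  note Fp = fmor_arr[OF E p] and Fi = fmor_arr[OF E i]
  have Yo: "Y \<in> Ob C" using arr_tgt[OF p] .
  have "fmor F p \<bullet>\<^bsub>C\<^esub> fmor F i = Idm C (fob F Y)"
    using fmor_comp[OF E i p] pi fmor_id[OF E Yo] by simp
  then have 1: "(fmor F p \<bullet>\<^bsub>C\<^esub> b) \<bullet>\<^bsub>C\<^esub> (a \<bullet>\<^bsub>C\<^esub> fmor F i) = Idm C (fob F Y)"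
    using comp_inverse[OF Fi Fp a b _ ba] by simp
  note Fpb = arr_comp[OF b Fp]
  have "(a \<bullet>\<^bsub>C\<^esub> fmor F i) \<bullet>\<^bsub>C\<^esub> (fmor F p \<bullet>\<^bsub>C\<^esub> b) = a \<bullet>\<^bsub>C\<^esub> (fmor F i \<bullet>\<^bsub>C\<^esub> (fmor F p \<bullet>\<^bsub>C\<^esub> b))"
    using arr_assoc[OF Fpb Fi a] .
  also have "\<dots> = (a \<bullet>\<^bsub>C\<^esub> fmor F e') \<bullet>\<^bsub>C\<^esub> b"
    using arr_assoc[OF b Fp Fi] fmor_comp[OF E p i] ip arr_assoc[OF b Fe'a a] by simp
  also have "\<dots> = e" using aFe' arr_assoc[OF b a e] ab comp_id[OF e] by simp
  finally have 2: "(a \<bullet>\<^bsub>C\<^esub> fmor F i) \<bullet>\<^bsub>C\<^esub> (fmor F p \<bullet>\<^bsub>C\<^esub> b) = e" .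
  show "\<exists>Y\<in>Ob C. \<exists>p\<in>Mor C V Y. \<exists>i\<in>Mor C Y V. p \<bullet>\<^bsub>C\<^esub> i = Idm C Y \<and> i \<bullet>\<^bsub>C\<^esub> p = e"
    using 1 2 fob_Ob[OF E Yo] arr_Mor[OF Fpb] arr_Mor[OF arr_comp[OF Fi a]] by blast
qed

text \<open>Essential surjectivity replaces the target by some \<open>F X'\<close>. The image of an
  approximation of \<open>X'\<close> works because every test map out of an \<open>F U\<close> is
  \<open>fmor F u\<close> up to the chosen isomorphisms.\<close>

lemma contravariantly_finite_essential_image:
  assumes F: "autoequivalence C F" and sub: "\<U> \<subseteq> Ob C" and fin: "contravariantly_finite C \<U>"
  shows "contravariantly_finite C (essential_image C F \<U>)"
  unfolding contravariantly_finite_def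
proof
  fix X assume X: "X \<in> Ob C"
  note E = autoequivalence_endofunctor[OF F]
  have sub': "essential_image C F \<U> \<subseteq> Ob C" by (auto simp: essential_image_def)
  obtain X' a b where X': "X' \<in> Ob C" and a: "arr (fob F X') X a" and b: "arr X (fob F X') b"
    and ba: "b \<bullet>\<^bsub>C\<^esub> a = Idm C (fob F X')" and ab: "a \<bullet>\<^bsub>C\<^esub> b = Idm C X"
    using autoequivalence_surjE[OF F X] by metis
  obtain W f where "right_approximation C \<U> W X' f"
    using fin X' unfolding contravariantly_finite_def by blast
  then have W: "W \<in> \<U>" and f: "arr W X' f"
    and approx: "\<forall>V\<in>\<U>. \<forall>h. arr V X' h \<longrightarrow> (\<exists>t. arr V W t \<and> f \<bullet>\<^bsub>C\<^esub> t = h)"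
    unfolding right_approximation_iff[OF sub X'] by auto
  note Ff = fmor_arr[OF E f]
  have "\<exists>t. arr V (fob F W) t \<and> (a \<bullet>\<^bsub>C\<^esub> fmor F f) \<bullet>\<^bsub>C\<^esub> t = h"
    if V: "V \<in> essential_image C F \<U>" and h: "arr V X h" for V h
  proof -
    obtain U c d where U: "U \<in> \<U>" and c: "arr (fob F U) V c" and d: "arr V (fob F U) d"
      and cd: "c \<bullet>\<^bsub>C\<^esub> d = Idm C V"
      using essential_imageE[OF E sub V] by metis
    have Uo: "U \<in> Ob C" using U sub by blast
    have hc: "arr (fob F U) X (h \<bullet>\<^bsub>C\<^esub> c)" using arr_comp[OF c h] .
    obtain u where u: "arr U X' u" and Fu: "fmor F u = b \<bullet>\<^bsub>C\<^esub> (h \<bullet>\<^bsub>C\<^esub> c)"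
      using autoequivalence_full[OF F Uo X' arr_comp[OF hc b]] by blast
    obtain t where t: "arr U W t" "f \<bullet>\<^bsub>C\<^esub> t = u" using approx U u by blast
    note Ft = fmor_arr[OF E t(1)]
    note Ftd = arr_comp[OF d Ft]
    have "(a \<bullet>\<^bsub>C\<^esub> fmor F f) \<bullet>\<^bsub>C\<^esub> (fmor F t \<bullet>\<^bsub>C\<^esub> d) = a \<bullet>\<^bsub>C\<^esub> (fmor F u \<bullet>\<^bsub>C\<^esub> d)"
      using arr_assoc[OF Ftd Ff a] arr_assoc[OF d Ft Ff] fmor_comp[OF E t(1) f] t(2) by simp
    also have "\<dots> = h" unfolding Fu using conj_inverse_cancel[OF d c cd b a ab h] .
    finally show ?thesis using Ftd by blast
  qed
  then have "right_approximation C (essential_image C F \<U>) (fob F W) X (a \<bullet>\<^bsub>C\<^esub> fmor F f)"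
    unfolding right_approximation_iff[OF sub' X]
    using fob_essential_image[OF E sub W] arr_comp[OF Ff a] by blast
  then show "\<exists>W f. right_approximation C (essential_image C F \<U>) W X f" by blast
qed

lemma covariantly_finite_essential_image:
  assumes F: "autoequivalence C F" and sub: "\<U> \<subseteq> Ob C" and fin: "covariantly_finite C \<U>"
  shows "covariantly_finite C (essential_image C F \<U>)"
  unfolding covariantly_finite_def
proof
  fix X assume X: "X \<in> Ob C"
  note E = autoequivalence_endofunctor[OF F]
  have sub': "essential_image C F \<U> \<subseteq> Ob C" by (auto simp: essential_image_def)
  obtain X' a b where X': "X' \<in> Ob C" and a: "arr (fob F X') X a" and b: "arr X (fob F X') b"
    and ba: "b \<bullet>\<^bsub>C\<^esub> a = Idm C (fob F X')" and ab: "a \<bullet>\<^bsub>C\<^esub> b = Idm C X"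
    using autoequivalence_surjE[OF F X] by metis
  obtain W f where "left_approximation C \<U> X' W f"
    using fin X' unfolding covariantly_finite_def by blast
  then have W: "W \<in> \<U>" and f: "arr X' W f"
    and approx: "\<forall>V\<in>\<U>. \<forall>h. arr X' V h \<longrightarrow> (\<exists>t. arr W V t \<and> t \<bullet>\<^bsub>C\<^esub> f = h)"
    unfolding left_approximation_iff[OF sub X'] by auto
  note Ff = fmor_arr[OF E f]
  have "\<exists>t. arr (fob F W) V t \<and> t \<bullet>\<^bsub>C\<^esub> (fmor F f \<bullet>\<^bsub>C\<^esub> b) = h"
    if V: "V \<in> essential_image C F \<U>" and h: "arr X V h" for V h
  proof -
    obtain U c d where U: "U \<in> \<U>" and c: "arr (fob F U) V c" and d: "arr V (fob F U) d"
      and cd: "c \<bullet>\<^bsub>C\<^esub> d = Idm C V"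
      using essential_imageE[OF E sub V] by metis
    have Uo: "U \<in> Ob C" using U sub by blast
    have ha: "arr (fob F X') V (h \<bullet>\<^bsub>C\<^esub> a)" using arr_comp[OF a h] .
    have dha: "arr (fob F X') (fob F U) (d \<bullet>\<^bsub>C\<^esub> (h \<bullet>\<^bsub>C\<^esub> a))" using arr_comp[OF ha d] .
    obtain u where u: "arr X' U u" and Fu: "fmor F u = d \<bullet>\<^bsub>C\<^esub> (h \<bullet>\<^bsub>C\<^esub> a)"
      using autoequivalence_full[OF F X' Uo dha] by blast
    obtain t where t: "arr W U t" "t \<bullet>\<^bsub>C\<^esub> f = u" using approx U u by blast
    note Ft = fmor_arr[OF E t(1)]
    note Ffb = arr_comp[OF b Ff]
    have "(c \<bullet>\<^bsub>C\<^esub> fmor F t) \<bullet>\<^bsub>C\<^esub> (fmor F f \<bullet>\<^bsub>C\<^esub> b) = c \<bullet>\<^bsub>C\<^esub> (fmor F u \<bullet>\<^bsub>C\<^esub> b)"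
      using arr_assoc[OF Ffb Ft c] arr_assoc[OF b Ff Ft] fmor_comp[OF E f t(1)] t(2) by simp
    also have "\<dots> = h" unfolding Fu using conj_inverse_cancel[OF b a ab d c cd h] .
    finally show ?thesis using arr_comp[OF Ft c] by blast
  qed
  then have "left_approximation C (essential_image C F \<U>) X (fob F W) (fmor F f \<bullet>\<^bsub>C\<^esub> b)"
    unfolding left_approximation_iff[OF sub' X]
    using fob_essential_image[OF E sub W] arr_comp[OF b Ff] by blast
  then show "\<exists>W f. left_approximation C (essential_image C F \<U>) X W f" by blast
qed

lemma essential_image_comp:
  assumes F: "endofunctor C F" and G: "endofunctor C G" and sub: "\<U> \<subseteq> Ob C"
  shows "essential_image C (comp_endo F G) \<U> = essential_image C F (essential_image C G \<U>)"
proof (intro equalityI subsetI)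
  fix Y assume "Y \<in> essential_image C (comp_endo F G) \<U>"
  then obtain X where X: "X \<in> \<U>" "Y \<in> Ob C" "isomorphic C (fob F (fob G X)) Y"
    by (auto simp: essential_image_def comp_endo_def)
  then show "Y \<in> essential_image C F (essential_image C G \<U>)"
    using fob_essential_image[OF G sub X(1)] by (auto simp: essential_image_def)
next
  fix Y assume "Y \<in> essential_image C F (essential_image C G \<U>)"
  then obtain X Z where X: "X \<in> \<U>" "Z \<in> Ob C" "Y \<in> Ob C" "isomorphic C (fob G X) Z" "isomorphic C (fob F Z) Y"
    by (auto simp: essential_image_def)
  have o: "fob G X \<in> Ob C" using X sub fob_Ob[OF G] by blast
  have "isomorphic C (fob F (fob G X)) Y"
    using isomorphic_trans[OF fob_Ob[OF F o] fob_Ob[OF F X(2)] X(3) isomorphic_fob[OF F o X(2,4)] X(5)] .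
  then show "Y \<in> essential_image C (comp_endo F G) \<U>"
    using X by (auto simp: essential_image_def comp_endo_def)
qed

lemma essential_image_naturally_isomorphic:
  assumes F: "endofunctor C F" and G: "endofunctor C G" and sub: "\<U> \<subseteq> Ob C"
    and iso: "naturally_isomorphic C F G"
  shows "essential_image C F \<U> = essential_image C G \<U>"
proof -
  have "isomorphic C (fob F X) Y \<longleftrightarrow> isomorphic C (fob G X) Y" if X: "X \<in> \<U>" and Y: "Y \<in> Ob C" for X Y
  proof -
    have o: "X \<in> Ob C" "fob F X \<in> Ob C" "fob G X \<in> Ob C" using X sub fob_Ob F G by blast+
    have "isomorphic C (fob F X) (fob G X)"
      using iso o unfolding naturally_isomorphic_def isomorphic_def by blast
    then show ?thesis
      using o Y isomorphic_trans isomorphic_sym by blast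
  qed
  then show ?thesis by (auto simp: essential_image_def)
qed

end

section \<open>Triangles\<close>

context k_linear_triangulated_category
begin

lemmas Shift_endofunctor = autoequivalence_endofunctor[OF Shift_autoequivalence]

lemma tri_arr:
  assumes "(X, Y, Z, f, g, h) \<in> Tri D"
  shows "arr X Y f" "arr Y Z g" "arr Z (sh D X) h"
  using Tri_candidate[OF assms] fob_Ob[OF Shift_endofunctor, of X]
  by (simp_all add: candidate_triangle_def arr_def)

lemma shm_linear:
  "X \<in> Ob D \<Longrightarrow> Y \<in> Ob D \<Longrightarrow> linear_map K (Hom D X Y) (Hom D (sh D X) (sh D Y)) (shm D)"
  using Shift_linear by (simp add: linear_endofunctor_def)

lemma shm_zero:
  assumes "X \<in> Ob D" "Y \<in> Ob D"
  shows "shm D (zm X Y) = zm (sh D X) (sh D Y)"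
proof -
  have "zm X Y \<in> Mor D X Y" using arr_zero[OF assms] by (simp add: arr_def)
  then show ?thesis
    using linear_map_additive(1)[OF Hom_group[OF assms] Hom_group shm_linear[OF assms]]
      assms fob_Ob[OF Shift_endofunctor] by blast
qed

lemma shm_neg:
  assumes "arr X Y f"
  shows "shm D (\<ominus>\<^bsub>Hom D X Y\<^esub> f) = \<ominus>\<^bsub>Hom D (sh D X) (sh D Y)\<^esub> shm D f"
proof -
  have o: "X \<in> Ob D" "Y \<in> Ob D" "f \<in> Mor D X Y" using assms by (auto simp: arr_def)
  then show ?thesis
    using linear_map_additive(2)[OF Hom_group[OF o(1,2)] Hom_group shm_linear[OF o(1,2)]]
      fob_Ob[OF Shift_endofunctor] by blast
qed

section \<open>Rotation, cocones, weak kernels and weak cokernels\<close>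

lemma tri_rotate:
  assumes "(X, Y, Z, f, g, h) \<in> Tri D"
  shows "(Y, Z, sh D X, g, h, \<ominus>\<^bsub>Hom D (sh D X) (sh D Y)\<^esub> shm D f) \<in> Tri D"
  using TR2[OF Tri_candidate[OF assms]] assms by blast

lemma tri_cone: "arr X Y f \<Longrightarrow> \<exists>Z g h. (X, Y, Z, f, g, h) \<in> Tri D"
  using TR1_cone by (simp add: arr_def)

lemma is_iso_Idm: "X \<in> Ob D \<Longrightarrow> is_iso D X X (Idm D X)"
  using arr_Idm comp_id is_iso_iff by metis

text \<open>The translation is only an equivalence, so the cone of \<open>f\<close> is first
  replaced by an isomorphic object of the form \<open>sh D W\<close>; then \<open>TR2\<close> can be
  read backwards.\<close>

lemma tri_cocone:
  assumes f: "arr X Y f"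
  shows "\<exists>W w h. (W, X, Y, w, f, h) \<in> Tri D"
proof -
  note E = Shift_endofunctor
  obtain Z g h where T: "(X, Y, Z, f, g, h) \<in> Tri D" using tri_cone[OF f] by blast
  note g = tri_arr(2)[OF T] and h = tri_arr(3)[OF T]
  have o: "X \<in> Ob D" "Y \<in> Ob D" "Z \<in> Ob D" using f g by (auto simp: arr_def)
  obtain W a b where W: "W \<in> Ob D" and a: "arr (sh D W) Z a" and b: "arr Z (sh D W) b"
    and ba: "b \<bullet>\<^bsub>D\<^esub> a = Idm D (sh D W)" and ab: "a \<bullet>\<^bsub>D\<^esub> b = Idm D Z"
    using autoequivalence_surjE[OF Shift_autoequivalence o(3)] by metis
  note bg = arr_comp[OF g b] and ha = arr_comp[OF a h]
  have sW: "sh D W \<in> Ob D" using arr_src[OF a] .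
  have isob: "is_iso D Z (sh D W) b" using a b ab ba is_iso_iff[OF o(3) sW] by blast
  have eqs: "Idm D Y \<bullet>\<^bsub>D\<^esub> f = f \<bullet>\<^bsub>D\<^esub> Idm D X" "b \<bullet>\<^bsub>D\<^esub> g = (b \<bullet>\<^bsub>D\<^esub> g) \<bullet>\<^bsub>D\<^esub> Idm D Y"
      "shm D (Idm D X) \<bullet>\<^bsub>D\<^esub> h = (h \<bullet>\<^bsub>D\<^esub> a) \<bullet>\<^bsub>D\<^esub> b"
    using comp_id[OF f] id_comp[OF f] comp_id[OF bg] fmor_id[OF E o(1)] id_comp[OF h]
      arr_assoc[OF b a h] ab comp_id[OF h] by simp_all
  have "candidate_triangle D (X, Y, sh D W, f, b \<bullet>\<^bsub>D\<^esub> g, h \<bullet>\<^bsub>D\<^esub> a)"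
    using f bg ha by (simp add: candidate_triangle_def arr_def)
  then have T': "(X, Y, sh D W, f, b \<bullet>\<^bsub>D\<^esub> g, h \<bullet>\<^bsub>D\<^esub> a) \<in> Tri D"
    using TR1_iso[OF T _ is_iso_Idm[OF o(1)] is_iso_Idm[OF o(2)] isob eqs] by blast
  obtain w where w: "arr W X w" and Sw: "shm D w = h \<bullet>\<^bsub>D\<^esub> a"
    using autoequivalence_full[OF Shift_autoequivalence W o(1) ha] by blast
  \<comment> \<open>Rotation introduces a sign, so the first map of the triangle is the negative of
    the lift \<open>w\<close>.\<close>
  define w' where "w' = \<ominus>\<^bsub>Hom D W X\<^esub> w"
  have w': "arr W X w'" unfolding w'_def using arr_neg[OF w] .
  have "\<ominus>\<^bsub>Hom D (sh D W) (sh D X)\<^esub> shm D w' = h \<bullet>\<^bsub>D\<^esub> a"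
    unfolding w'_def using shm_neg[OF w] neg_neg[OF ha] Sw by simp
  moreover have "candidate_triangle D (W, X, Y, w', f, b \<bullet>\<^bsub>D\<^esub> g)"
    using f w' bg by (simp add: candidate_triangle_def arr_def)
  ultimately have "(W, X, Y, w', f, b \<bullet>\<^bsub>D\<^esub> g) \<in> Tri D" using TR2 T' by simp
  then show ?thesis by blast
qed

text \<open>Compare with the triangle on the identity of \<open>X\<close> and a zero object:
  \<open>TR3\<close> with vertical maps \<open>Idm D X\<close> and \<open>f\<close> makes
  \<open>g f\<close> factor through zero.\<close>

lemma tri_comp_zero:
  assumes T: "(X, Y, Z, f, g, h) \<in> Tri D"
  shows "g \<bullet>\<^bsub>D\<^esub> f = zm X Z"
proof -
  note f = tri_arr(1)[OF T] and g = tri_arr(2)[OF T]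
  have X: "X \<in> Ob D" using arr_src[OF f] .
  obtain N where N: "zero_object D N" using zero_object_exists by blast
  then have No: "N \<in> Ob D" by (simp add: zero_object_def)
  obtain c where c: "c \<in> Mor D N Z" "c \<bullet>\<^bsub>D\<^esub> zm X N = g \<bullet>\<^bsub>D\<^esub> f"
    using TR3[OF TR1_id[OF X N] T _ _ refl] arr_Mor[OF f] arr_Mor[OF arr_Idm[OF X]]
      comp_id[OF f] by metis
  have "arr N Z c" using c No arr_tgt[OF g] by (simp add: arr_def)
  then show ?thesis using comp_zero X c(2) by simp
qed

lemma tri_comp_zero':
  assumes T: "(X, Y, Z, f, g, h) \<in> Tri D"
  shows "shm D f \<bullet>\<^bsub>D\<^esub> h = zm Z (sh D Y)"
proof -
  note Sf = fmor_arr[OF Shift_endofunctor tri_arr(1)[OF T]]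
  note h = tri_arr(3)[OF T]
  have "\<ominus>\<^bsub>Hom D Z (sh D Y)\<^esub> (shm D f \<bullet>\<^bsub>D\<^esub> h) = zm Z (sh D Y)"
    using tri_comp_zero[OF tri_rotate[OF tri_rotate[OF T]]] neg_comp[OF h Sf] by simp
  then show ?thesis using neg_eq_zero_iff[OF arr_comp[OF h Sf]] by simp
qed

text \<open>\<open>TR3\<close> into a triangle whose second map is the identity of \<open>W\<close>,
  with the zero map in the first place and \<open>u\<close> in the second; the third vertical map is
  the factorization.\<close>

lemma tri_weak_cokernel:
  assumes T: "(X, Y, Z, f, g, h) \<in> Tri D" and u: "arr Y W u" and uf: "u \<bullet>\<^bsub>D\<^esub> f = zm X W"
  shows "\<exists>t. arr Z W t \<and> t \<bullet>\<^bsub>D\<^esub> g = u"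
proof -
  note f = tri_arr(1)[OF T] and g = tri_arr(2)[OF T]
  have W: "W \<in> Ob D" and X: "X \<in> Ob D" using u f by (auto simp: arr_def)
  obtain V w k where T': "(V, W, W, w, Idm D W, k) \<in> Tri D" using tri_cocone[OF arr_Idm[OF W]] by blast
  note w = tri_arr(1)[OF T']
  have "u \<bullet>\<^bsub>D\<^esub> f = w \<bullet>\<^bsub>D\<^esub> zm X V" using comp_zero[OF w X] uf by simp
  then obtain t where "t \<in> Mor D Z W" "t \<bullet>\<^bsub>D\<^esub> g = Idm D W \<bullet>\<^bsub>D\<^esub> u"
    using TR3[OF T T' arr_Mor[OF arr_zero[OF X arr_src[OF w]]] arr_Mor[OF u]] by blast
  then show ?thesis using id_comp[OF u] W arr_tgt[OF g] by (auto simp: arr_def)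
qed

text \<open>\<open>TR3\<close> produces third vertical maps, so both triangles are rotated first:
  the wanted \<open>u\<close> then appears shifted, as a map from \<open>sh D W\<close> to
  \<open>sh D X\<close>. The signs of the two rotations cancel, and full faithfulness of the
  translation undoes the shift.\<close>

lemma tri_weak_kernel:
  assumes T: "(X, Y, Z, f, g, h) \<in> Tri D" and v: "arr W Y v" and gv: "g \<bullet>\<^bsub>D\<^esub> v = zm W Z"
  shows "\<exists>u. arr W X u \<and> f \<bullet>\<^bsub>D\<^esub> u = v"
proof -
  note f = tri_arr(1)[OF T] and g = tri_arr(2)[OF T]
  note E = Shift_endofunctor
  have o: "W \<in> Ob D" "X \<in> Ob D" "Y \<in> Ob D" "Z \<in> Ob D" using v f g by (auto simp: arr_def)
  obtain N where N: "zero_object D N" using zero_object_exists by blast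
  then have No: "N \<in> Ob D" by (simp add: zero_object_def)
  note T1 = tri_rotate[OF TR1_id[OF o(1) N]]
  have "zm N Z \<bullet>\<^bsub>D\<^esub> zm W N = g \<bullet>\<^bsub>D\<^esub> v" using comp_zero[OF arr_zero[OF No o(4)] o(1)] gv by simp
  then obtain c where c0: "c \<in> Mor D (sh D W) (sh D X)"
    and c1: "shm D v \<bullet>\<^bsub>D\<^esub> (\<ominus>\<^bsub>Hom D (sh D W) (sh D W)\<^esub> shm D (Idm D W)) =
      (\<ominus>\<^bsub>Hom D (sh D X) (sh D Y)\<^esub> shm D f) \<bullet>\<^bsub>D\<^esub> c"
    using TR3[OF T1 tri_rotate[OF T] arr_Mor[OF v] arr_Mor[OF arr_zero[OF No o(4)]]] by blast
  have so: "sh D W \<in> Ob D" "sh D X \<in> Ob D" using fob_Ob[OF E] o by auto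
  have c: "arr (sh D W) (sh D X) c" using c0 so by (simp add: arr_def)
  note Sv = fmor_arr[OF E v] and Sf = fmor_arr[OF E f]
  have "\<ominus>\<^bsub>Hom D (sh D W) (sh D Y)\<^esub> shm D v = \<ominus>\<^bsub>Hom D (sh D W) (sh D Y)\<^esub> (shm D f \<bullet>\<^bsub>D\<^esub> c)"
    using c1 comp_neg[OF Sv arr_Idm[OF so(1)]] comp_id[OF Sv] neg_comp[OF c Sf] fmor_id[OF E o(1)] by simp
  then have eq: "shm D v = shm D f \<bullet>\<^bsub>D\<^esub> c" using neg_neg[OF Sv] neg_neg[OF arr_comp[OF c Sf]] by metis
  obtain u where u: "arr W X u" "shm D u = c"
    using autoequivalence_full[OF Shift_autoequivalence o(1,2) c] by blast
  then have "shm D (f \<bullet>\<^bsub>D\<^esub> u) = shm D v" using fmor_comp[OF E u(1) f] eq by simp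
  then have "f \<bullet>\<^bsub>D\<^esub> u = v"
    using autoequivalence_faithful[OF Shift_autoequivalence arr_comp[OF u(1) f] v] by simp
  with u show ?thesis by blast
qed

section \<open>Stable t-structures from approximations\<close>

lemma
  assumes "triangulated_subcategory D \<U>"
  shows tri_sub_Ob: "\<U> \<subseteq> Ob D"
    and tri_sub_iso: "X \<in> \<U> \<Longrightarrow> Y \<in> Ob D \<Longrightarrow> isomorphic D X Y \<Longrightarrow> Y \<in> \<U>"
    and tri_sub_ess: "essential_image D (Shift D) \<U> = \<U>"
    and tri_sub_cone: "(X, Y, Z, f, g, h) \<in> Tri D \<Longrightarrow> X \<in> \<U> \<Longrightarrow> Y \<in> \<U> \<Longrightarrow> Z \<in> \<U>"
  using assms unfolding triangulated_subcategory_def by blast+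

lemma sh_essential_image_iff:
  assumes sub: "\<U> \<subseteq> Ob D" and ess: "essential_image D (Shift D) \<U> = \<U>" and X: "X \<in> Ob D"
  shows "sh D X \<in> \<U> \<longleftrightarrow> X \<in> \<U>"
proof
  assume "X \<in> \<U>"
  then show "sh D X \<in> \<U>" using fob_essential_image[OF Shift_endofunctor sub] ess by blast
next
  assume "sh D X \<in> \<U>"
  then obtain X' where X': "X' \<in> \<U>" "isomorphic D (sh D X') (sh D X)"
    using ess by (auto simp: essential_image_def)
  have X'o: "X' \<in> Ob D" using X' sub by blast
  have X'X: "isomorphic D X' X" using isomorphic_reflect[OF Shift_autoequivalence X'o X X'(2)] .
  \<comment> \<open>Closure under isomorphism comes from \<open>ess\<close> itself:
    \<open>X'\<close> is isomorphic to some \<open>sh D Y\<close>, and then so is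
    \<open>X\<close>.\<close>
  obtain Y where Y: "Y \<in> \<U>" "isomorphic D (sh D Y) X'"
    using ess X' by (auto simp: essential_image_def)
  have Yo: "Y \<in> Ob D" using Y sub by blast
  have "isomorphic D (sh D Y) X"
    using isomorphic_trans[OF fob_Ob[OF Shift_endofunctor Yo] X'o X Y(2) X'X] .
  then show "X \<in> \<U>" using ess Y(1) X by (auto simp: essential_image_def)
qed

lemma tri_sub_cocone:
  assumes U: "triangulated_subcategory D \<U>" and T: "(X, Y, Z, f, g, h) \<in> Tri D" and "Y \<in> \<U>" "Z \<in> \<U>"
  shows "X \<in> \<U>"
  using tri_sub_cone[OF U tri_rotate[OF T]] assms(3,4) arr_src[OF tri_arr(1)[OF T]]
    sh_essential_image_iff[OF tri_sub_Ob[OF U] tri_sub_ess[OF U]] by blast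

lemma thick_retract:
  assumes U: "thick_subcategory D \<U>" and split: "idempotents_split_on D \<U>"
    and W: "W \<in> \<U>" and i: "arr X W i" and p: "arr W X p" and pi: "p \<bullet>\<^bsub>D\<^esub> i = Idm D X"
  shows "X \<in> \<U>"
  using retract_direct_summand[OF split W i p pi] U W unfolding thick_subcategory_def by blast

text \<open>Here the data of the splitting argument are built from triangles. The map
  \<open>g\<close> exists because \<open>f (k a) = 0\<close> and \<open>c\<close> is a weak cokernel
  of \<open>k a\<close>; the lift \<open>s\<close> exists because the cone \<open>V\<close> lies in
  \<open>\<U>\<close>, so that \<open>f\<close> approximates maps out of it.\<close>

lemma coreflection_exists:
  assumes U: "thick_subcategory D \<U>" and split: "idempotents_split_on D \<U>"
    and fin: "contravariantly_finite D \<U>" and X: "X \<in> Ob D"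
  shows "\<exists>Y r. Y \<in> \<U> \<and> arr Y X r \<and>
    (\<forall>W\<in>\<U>. \<forall>h. arr W X h \<longrightarrow> (\<exists>t. arr W Y t \<and> r \<bullet>\<^bsub>D\<^esub> t = h)) \<and>
    (\<forall>W\<in>\<U>. \<forall>t. arr W Y t \<and> r \<bullet>\<^bsub>D\<^esub> t = zm W X \<longrightarrow> t = zm W Y)"
proof -
  have TU: "triangulated_subcategory D \<U>" using U by (simp add: thick_subcategory_def)
  note sub = tri_sub_Ob[OF TU]
  have approx_ex: "\<exists>W f. W \<in> \<U> \<and> arr W X f \<and> (\<forall>V\<in>\<U>. \<forall>h. arr V X h \<longrightarrow> (\<exists>t. arr V W t \<and> f \<bullet>\<^bsub>D\<^esub> t = h))"
    if X: "X \<in> Ob D" for X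
  proof -
    obtain W f where "right_approximation D \<U> W X f"
      using fin X unfolding contravariantly_finite_def by blast
    then show ?thesis using right_approximation_iff[OF sub X] by blast
  qed
  obtain U f where Uu: "U \<in> \<U>" and f: "arr U X f"
    and approx: "\<forall>V\<in>\<U>. \<forall>h. arr V X h \<longrightarrow> (\<exists>t. arr V U t \<and> f \<bullet>\<^bsub>D\<^esub> t = h)"
    using approx_ex[OF X] by blast
  obtain R k l where T: "(R, U, X, k, f, l) \<in> Tri D" using tri_cocone[OF f] by blast
  note k = tri_arr(1)[OF T]
  obtain U' a where Uu': "U' \<in> \<U>" and a: "arr U' R a"
    and approx': "\<forall>V\<in>\<U>. \<forall>h. arr V R h \<longrightarrow> (\<exists>t. arr V U' t \<and> a \<bullet>\<^bsub>D\<^esub> t = h)"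
    using approx_ex[OF arr_src[OF k]] by blast
  note ka = arr_comp[OF a k]
  obtain V c m where T': "(U', U, V, k \<bullet>\<^bsub>D\<^esub> a, c, m) \<in> Tri D" using tri_cone[OF ka] by blast
  note c = tri_arr(2)[OF T']
  have Vu: "V \<in> \<U>" using tri_sub_cone[OF TU T' Uu' Uu] .
  have "f \<bullet>\<^bsub>D\<^esub> (k \<bullet>\<^bsub>D\<^esub> a) = zm U' X"
    using arr_assoc[OF a k f] tri_comp_zero[OF T] zero_comp[OF a X] by simp
  then obtain g where g: "arr V X g" and gc: "g \<bullet>\<^bsub>D\<^esub> c = f" using tri_weak_cokernel[OF T' f] by blast
  obtain s where s: "arr V U s" and fs: "f \<bullet>\<^bsub>D\<^esub> s = g" using approx Vu g by blast
  \<comment> \<open>A map killed by \<open>f\<close> factors through \<open>k\<close> by the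
    triangle, then through \<open>k a\<close> by the second approximation, and
    \<open>c (k a) = 0\<close>.\<close>
  have kill: "c \<bullet>\<^bsub>D\<^esub> w = zm W V" if W: "W \<in> \<U>" and w: "arr W U w" and fw: "f \<bullet>\<^bsub>D\<^esub> w = zm W X" for W w
  proof -
    obtain t where t: "arr W R t" "k \<bullet>\<^bsub>D\<^esub> t = w" using tri_weak_kernel[OF T w fw] by blast
    obtain t' where t': "arr W U' t'" "a \<bullet>\<^bsub>D\<^esub> t' = t" using approx' W t by blast
    have "(k \<bullet>\<^bsub>D\<^esub> a) \<bullet>\<^bsub>D\<^esub> t' = w" using arr_assoc[OF t'(1) a k] t t' by simp
    then show ?thesis
      using arr_assoc[OF t'(1) ka c] tri_comp_zero[OF T'] zero_comp[OF t'(1) arr_tgt[OF c]] by simp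
  qed
  have approx2: "\<And>W h. W \<in> \<U> \<Longrightarrow> arr W X h \<Longrightarrow> \<exists>t. arr W U t \<and> f \<bullet>\<^bsub>D\<^esub> t = h" using approx by blast
  show ?thesis
    using coreflection_of_splitting[OF split Uu Vu f c g s gc fs approx2 kill]
      thick_retract[OF U split Vu] by blast
qed

text \<open>Dual to the coreflection. Now \<open>V\<close> is the first vertex of a triangle whose
  other two lie in \<open>\<U>\<close>, so membership comes from
  \<open>tri_sub_cocone\<close>.\<close>

lemma reflection_exists:
  assumes U: "thick_subcategory D \<U>" and split: "idempotents_split_on D \<U>"
    and fin: "covariantly_finite D \<U>" and X: "X \<in> Ob D"
  shows "\<exists>Y r. Y \<in> \<U> \<and> arr X Y r \<and>
    (\<forall>W\<in>\<U>. \<forall>h. arr X W h \<longrightarrow> (\<exists>t. arr Y W t \<and> t \<bullet>\<^bsub>D\<^esub> r = h)) \<and>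
    (\<forall>W\<in>\<U>. \<forall>t. arr Y W t \<and> t \<bullet>\<^bsub>D\<^esub> r = zm X W \<longrightarrow> t = zm Y W)"
proof -
  have TU: "triangulated_subcategory D \<U>" using U by (simp add: thick_subcategory_def)
  note sub = tri_sub_Ob[OF TU]
  have approx_ex: "\<exists>W f. W \<in> \<U> \<and> arr X W f \<and> (\<forall>V\<in>\<U>. \<forall>h. arr X V h \<longrightarrow> (\<exists>t. arr W V t \<and> t \<bullet>\<^bsub>D\<^esub> f = h))"
    if X: "X \<in> Ob D" for X
  proof -
    obtain W f where "left_approximation D \<U> X W f"
      using fin X unfolding covariantly_finite_def by blast
    then show ?thesis using left_approximation_iff[OF sub X] by blast
  qed
  obtain U f where Uu: "U \<in> \<U>" and f: "arr X U f"
    and approx: "\<forall>V\<in>\<U>. \<forall>h. arr X V h \<longrightarrow> (\<exists>t. arr U V t \<and> t \<bullet>\<^bsub>D\<^esub> f = h)"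
    using approx_ex[OF X] by blast
  obtain R k l where T: "(X, U, R, f, k, l) \<in> Tri D" using tri_cone[OF f] by blast
  note k = tri_arr(2)[OF T]
  obtain U' a where Uu': "U' \<in> \<U>" and a: "arr R U' a"
    and approx': "\<forall>V\<in>\<U>. \<forall>h. arr R V h \<longrightarrow> (\<exists>t. arr U' V t \<and> t \<bullet>\<^bsub>D\<^esub> a = h)"
    using approx_ex[OF arr_tgt[OF k]] by blast
  note ak = arr_comp[OF k a]
  obtain V c m where T': "(V, U, U', c, a \<bullet>\<^bsub>D\<^esub> k, m) \<in> Tri D" using tri_cocone[OF ak] by blast
  note c = tri_arr(1)[OF T']
  have Vu: "V \<in> \<U>" using tri_sub_cocone[OF TU T' Uu Uu'] .
  have "(a \<bullet>\<^bsub>D\<^esub> k) \<bullet>\<^bsub>D\<^esub> f = zm X U'"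
    using arr_assoc[OF f k a] tri_comp_zero[OF T] comp_zero[OF a X] by simp
  then obtain g where g: "arr X V g" and cg: "c \<bullet>\<^bsub>D\<^esub> g = f" using tri_weak_kernel[OF T' f] by blast
  obtain s where s: "arr U V s" and sf: "s \<bullet>\<^bsub>D\<^esub> f = g" using approx Vu g by blast
  have kill: "w \<bullet>\<^bsub>D\<^esub> c = zm V W" if W: "W \<in> \<U>" and w: "arr U W w" and wf: "w \<bullet>\<^bsub>D\<^esub> f = zm X W" for W w
  proof -
    obtain t where t: "arr R W t" "t \<bullet>\<^bsub>D\<^esub> k = w" using tri_weak_cokernel[OF T w wf] by blast
    obtain t' where t': "arr U' W t'" "t' \<bullet>\<^bsub>D\<^esub> a = t" using approx' W t by blast
    have "t' \<bullet>\<^bsub>D\<^esub> (a \<bullet>\<^bsub>D\<^esub> k) = w" using arr_assoc[OF k a t'(1)] t t' by simp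
    then show ?thesis
      using arr_assoc[OF c ak t'(1)] tri_comp_zero[OF T'] comp_zero[OF t'(1) arr_src[OF c]] by simp
  qed
  have approx2: "\<And>W h. W \<in> \<U> \<Longrightarrow> arr X W h \<Longrightarrow> \<exists>t. arr U W t \<and> t \<bullet>\<^bsub>D\<^esub> f = h" using approx by blast
  show ?thesis
    using reflection_of_splitting[OF split Uu Vu f c g s cg sf approx2 kill]
      thick_retract[OF U split Vu] by blast
qed

section \<open>Perpendicular subcategories\<close>

lemma right_perp_iff:
  assumes "\<U> \<subseteq> Ob D"
  shows "T \<in> right_perp D \<U> \<longleftrightarrow> T \<in> Ob D \<and> (\<forall>U\<in>\<U>. \<forall>f. arr U T f \<longrightarrow> f = zm U T)"
proof -
  have "(\<forall>U\<in>\<U>. Mor D U T = {zm U T}) \<longleftrightarrow> (\<forall>U\<in>\<U>. \<forall>f. arr U T f \<longrightarrow> f = zm U T)" if "T \<in> Ob D"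
    using assms that by (intro ball_cong refl hom_trivial_iff) auto
  then show ?thesis by (auto simp: right_perp_def hom_vanishes_def)
qed

text \<open>Shift-stability of \<open>\<U>\<close> makes the perpendicular category shift-stable, by
  full faithfulness of the translation. Hence the lemma can be applied twice, and the double
  perpendicular category is thick too.\<close>

lemma thick_right_perp:
  assumes sub: "\<U> \<subseteq> Ob D" and ess: "essential_image D (Shift D) \<U> = \<U>"
  shows "thick_subcategory D (right_perp D \<U>)"
proof -
  let ?P = "right_perp D \<U>"
  note P = right_perp_iff[OF sub] and E = Shift_endofunctor
  have Po: "?P \<subseteq> Ob D" by (auto simp: right_perp_def)
  have PM: "T \<in> ?P \<longleftrightarrow> T \<in> Ob D \<and> (\<forall>U\<in>\<U>. Mor D U T = {zm U T})" for T
    by (auto simp: right_perp_def hom_vanishes_def)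
  have retr: "Y \<in> ?P" if "X \<in> ?P"
    and j: "arr Y X j" and q: "arr X Y q" and qj: "q \<bullet>\<^bsub>D\<^esub> j = Idm D Y" for X Y j q
  proof -
    have "Mor D U Y = {zm U Y}" if U: "U \<in> \<U>" for U
    proof -
      have Uo: "U \<in> Ob D" using U sub by blast
      have "Mor D U X = {zm U X}" using \<open>X \<in> ?P\<close> U PM by blast
      then show ?thesis
        using hom_trivial_retract[OF _ arr_Idm[OF Uo] arr_Idm[OF Uo] comp_id[OF arr_Idm[OF Uo]] j q qj]
        by blast
    qed
    then show ?thesis using PM arr_src[OF j] by blast
  qed
  have Piso: "Y \<in> ?P" if "X \<in> ?P" "Y \<in> Ob D" "isomorphic D X Y" for X Y
    using that retr isomorphic_iff Po by (meson subsetD)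
  have shP: "sh D T \<in> ?P \<longleftrightarrow> T \<in> ?P" if T: "T \<in> Ob D" for T
  proof
    assume "sh D T \<in> ?P"
    then have "Mor D U T = {zm U T}" if "U \<in> \<U>" for U
    proof -
      have U: "U \<in> Ob D" "sh D U \<in> \<U>" using that sub sh_essential_image_iff[OF sub ess] by blast+
      then show ?thesis
        using \<open>sh D T \<in> ?P\<close> PM hom_trivial_autoequivalence[OF Shift_autoequivalence U(1) T] by blast
    qed
    then show "T \<in> ?P" using T PM by blast
  next
    assume TP: "T \<in> ?P"
    have "Mor D U (sh D T) = {zm U (sh D T)}" if Uu: "U \<in> \<U>" for U
    proof -
      obtain U' where U': "U' \<in> \<U>" "isomorphic D (sh D U') U"
        using ess Uu by (auto simp: essential_image_def)
      have o: "U' \<in> Ob D" "U \<in> Ob D" using U' Uu sub by auto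
      have "Mor D (sh D U') (sh D T) = {zm (sh D U') (sh D T)}"
        using hom_trivial_autoequivalence[OF Shift_autoequivalence o(1) T] TP U' PM by blast
      then show ?thesis
        using hom_trivial_isomorphic[OF fob_Ob[OF E o(1)] o(2) fob_Ob[OF E T] fob_Ob[OF E T] U'(2)]
          isomorphic_refl[OF fob_Ob[OF E T]] by blast
    qed
    then show "sh D T \<in> ?P" using PM fob_Ob[OF E T] by blast
  qed
  have essP: "essential_image D (Shift D) ?P = ?P"
  proof (intro equalityI subsetI)
    fix Y assume "Y \<in> essential_image D (Shift D) ?P"
    then obtain X where "X \<in> ?P" "Y \<in> Ob D" "isomorphic D (sh D X) Y" by (auto simp: essential_image_def)
    then show "Y \<in> ?P" using Piso shP Po by blast
  next
    fix Y assume Y: "Y \<in> ?P"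
    then have Yo: "Y \<in> Ob D" using Po by blast
    obtain X where X: "X \<in> Ob D" "isomorphic D (sh D X) Y"
      using autoequivalence_surj[OF Shift_autoequivalence Yo] by blast
    have "sh D X \<in> ?P"
      using Piso[OF Y fob_Ob[OF E X(1)] isomorphic_sym[OF fob_Ob[OF E X(1)] Yo X(2)]] .
    then show "Y \<in> essential_image D (Shift D) ?P"
      using shP[OF X(1)] X Yo by (auto simp: essential_image_def)
  qed
  \<comment> \<open>A map from \<open>\<U>\<close> into \<open>Z\<close> becomes zero in
    \<open>sh D X\<close>, hence factors through \<open>Y\<close>, where it vanishes.\<close>
  have cone: "Z \<in> ?P" if T: "(X, Y, Z, f, g, h) \<in> Tri D" and XY: "X \<in> ?P" "Y \<in> ?P" for X Y Z f g h
  proof -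
    note f = tri_arr(1)[OF T] and g = tri_arr(2)[OF T] and h = tri_arr(3)[OF T]
    have sX: "sh D X \<in> ?P" using shP[OF arr_src[OF f]] XY by blast
    have "v = zm W Z" if W: "W \<in> \<U>" and v: "arr W Z v" for W v
    proof -
      have "h \<bullet>\<^bsub>D\<^esub> v = zm W (sh D X)" using sX W arr_comp[OF v h] P by blast
      then obtain y where y: "arr W Y y" "g \<bullet>\<^bsub>D\<^esub> y = v"
        using tri_weak_kernel[OF tri_rotate[OF T] v] by blast
      then have "y = zm W Y" using XY W P by blast
      then show ?thesis using y comp_zero[OF g] sub W by blast
    qed
    then show ?thesis using P arr_tgt[OF g] by blast
  qed
  have "\<exists>N\<in>?P. zero_object D N"
  proof -
    obtain N where N: "zero_object D N" using zero_object_exists by blast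
    then have "N \<in> ?P" using sub by (auto simp: PM zero_object_def)
    with N show ?thesis by blast
  qed
  then have "triangulated_subcategory D ?P"
    unfolding triangulated_subcategory_def using Po Piso essP cone by blast
  moreover have "X \<in> ?P \<and> Y \<in> ?P" if S: "direct_sum D X Y W" and W: "W \<in> ?P" for X Y W
  proof -
    have o: "X \<in> Ob D" "Y \<in> Ob D" "W \<in> Ob D" using S by (auto simp: direct_sum_def)
    obtain i j p q where "i \<in> Mor D X W" "j \<in> Mor D Y W" "p \<in> Mor D W X" "q \<in> Mor D W Y"
      "p \<bullet>\<^bsub>D\<^esub> i = Idm D X" "q \<bullet>\<^bsub>D\<^esub> j = Idm D Y"
      using S unfolding direct_sum_def by blast
    then show ?thesis using retr[OF W] o unfolding arr_def by blast
  qed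
  ultimately show ?thesis unfolding thick_subcategory_def by blast
qed

section \<open>Decomposition triangles and double perpendiculars\<close>

definition left_perp :: "'o set \<Rightarrow> 'o set" where
  "left_perp \<U> = {T \<in> Ob D. hom_vanishes D {T} \<U>}"

text \<open>Surjectivity and injectivity of composition with \<open>r\<close> act separately. For
  \<open>v\<close> from \<open>W\<close> into the cone, injectivity one shift down gives
  \<open>h v = 0\<close>, so \<open>v\<close> lifts to \<open>X\<close>. Surjectivity lifts it
  further through \<open>r\<close>, and \<open>g r = 0\<close>.\<close>

lemma coreflection_triangle:
  assumes U: "thick_subcategory D \<U>" and split: "idempotents_split_on D \<U>"
    and fin: "contravariantly_finite D \<U>" and X: "X \<in> Ob D"
  shows "\<exists>Y\<in>\<U>. \<exists>V\<in>right_perp D \<U>. \<exists>f g h. (Y, X, V, f, g, h) \<in> Tri D"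
proof -
  have TU: "triangulated_subcategory D \<U>" using U by (simp add: thick_subcategory_def)
  note sub = tri_sub_Ob[OF TU] and ess = tri_sub_ess[OF TU] and E = Shift_endofunctor
  obtain Y r where Y: "Y \<in> \<U>" and r: "arr Y X r"
    and sur: "\<And>W h. W \<in> \<U> \<Longrightarrow> arr W X h \<Longrightarrow> \<exists>t. arr W Y t \<and> r \<bullet>\<^bsub>D\<^esub> t = h"
    and inj: "\<And>W t. W \<in> \<U> \<Longrightarrow> arr W Y t \<Longrightarrow> r \<bullet>\<^bsub>D\<^esub> t = zm W X \<Longrightarrow> t = zm W Y"
    using coreflection_exists[OF assms] by blast
  obtain V g h where T: "(Y, X, V, r, g, h) \<in> Tri D" using tri_cone[OF r] by blast
  note g = tri_arr(2)[OF T] and h = tri_arr(3)[OF T]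
  have Yo: "Y \<in> Ob D" and sYo: "sh D Y \<in> Ob D" using arr_src[OF r] arr_tgt[OF h] .
  have "v = zm W V" if W: "W \<in> \<U>" and v: "arr W V v" for W v
  proof -
    have Wo: "W \<in> Ob D" using W sub by blast
    \<comment> \<open>Injectivity concerns maps into \<open>Y\<close>, whereas \<open>h v\<close>
      ends in \<open>sh D Y\<close>. Writing \<open>W\<close> as a shift up to isomorphism allows
      \<open>h v\<close> to be desuspended to \<open>t\<close>.\<close>
    have "W \<in> essential_image D (Shift D) \<U>" using W ess by simp
    then obtain W' a b where W': "W' \<in> \<U>" and a: "arr (sh D W') W a" and b: "arr W (sh D W') b"
      and ab: "a \<bullet>\<^bsub>D\<^esub> b = Idm D W"
      using essential_imageE[OF E sub] by metis
    have W'o: "W' \<in> Ob D" using W' sub by blast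
    note hv = arr_comp[OF v h]
    note hva = arr_comp[OF a hv]
    obtain t where t: "arr W' Y t" and St: "shm D t = (h \<bullet>\<^bsub>D\<^esub> v) \<bullet>\<^bsub>D\<^esub> a"
      using autoequivalence_full[OF Shift_autoequivalence W'o Yo hva] by blast
    note Sr = fmor_arr[OF E r]
    have "shm D r \<bullet>\<^bsub>D\<^esub> (h \<bullet>\<^bsub>D\<^esub> v) = zm W (sh D X)"
      using arr_assoc[OF v h Sr] tri_comp_zero'[OF T] zero_comp[OF v arr_tgt[OF Sr]] by simp
    then have "shm D (r \<bullet>\<^bsub>D\<^esub> t) = shm D (zm W' X)"
      using fmor_comp[OF E t r] St arr_assoc[OF a hv Sr] zero_comp[OF a arr_tgt[OF Sr]]
        shm_zero[OF W'o X] by simp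
    then have "r \<bullet>\<^bsub>D\<^esub> t = zm W' X"
      using autoequivalence_faithful[OF Shift_autoequivalence arr_comp[OF t r] arr_zero[OF W'o X]] by simp
    then have "t = zm W' Y" using inj[OF W' t] by simp
    then have "(h \<bullet>\<^bsub>D\<^esub> v) \<bullet>\<^bsub>D\<^esub> a = zm (sh D W') (sh D Y)" using St shm_zero[OF W'o Yo] by simp
    then have "h \<bullet>\<^bsub>D\<^esub> v = zm W (sh D Y)"
      using arr_assoc[OF b a hv] ab comp_id[OF hv] zero_comp[OF b sYo] by simp
    then obtain x where x: "arr W X x" "g \<bullet>\<^bsub>D\<^esub> x = v"
      using tri_weak_kernel[OF tri_rotate[OF T] v] by blast
    obtain y where y: "arr W Y y" "r \<bullet>\<^bsub>D\<^esub> y = x" using sur[OF W x(1)] by blast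
    have "v = (g \<bullet>\<^bsub>D\<^esub> r) \<bullet>\<^bsub>D\<^esub> y" using arr_assoc[OF y(1) r g] x y by simp
    then show ?thesis using tri_comp_zero[OF T] zero_comp[OF y(1) arr_tgt[OF g]] by simp
  qed
  then have "V \<in> right_perp D \<U>" using right_perp_iff[OF sub] arr_tgt[OF g] by blast
  then show ?thesis using Y T by blast
qed

text \<open>Here \<open>v\<close> is shifted up instead: \<open>shm D v\<close> after
  \<open>h\<close> is killed by \<open>r\<close>, hence zero, so \<open>shm D v\<close> factors, up
  to sign, through \<open>shm D w\<close>. Desuspending the factor gives \<open>u\<close> on
  \<open>X\<close>, which extends over \<open>r\<close>, and \<open>r w = 0\<close> forces
  \<open>v = 0\<close>.\<close>

lemma reflection_triangle:
  assumes U: "thick_subcategory D \<U>" and split: "idempotents_split_on D \<U>"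
    and fin: "covariantly_finite D \<U>" and X: "X \<in> Ob D"
  shows "\<exists>V\<in>left_perp \<U>. \<exists>Y\<in>\<U>. \<exists>f g h. (V, X, Y, f, g, h) \<in> Tri D"
proof -
  have TU: "triangulated_subcategory D \<U>" using U by (simp add: thick_subcategory_def)
  note sub = tri_sub_Ob[OF TU] and ess = tri_sub_ess[OF TU] and E = Shift_endofunctor
  obtain Y r where Y: "Y \<in> \<U>" and r: "arr X Y r"
    and sur: "\<And>W h. W \<in> \<U> \<Longrightarrow> arr X W h \<Longrightarrow> \<exists>t. arr Y W t \<and> t \<bullet>\<^bsub>D\<^esub> r = h"
    and inj: "\<And>W t. W \<in> \<U> \<Longrightarrow> arr Y W t \<Longrightarrow> t \<bullet>\<^bsub>D\<^esub> r = zm X W \<Longrightarrow> t = zm Y W"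
    using reflection_exists[OF assms] by blast
  obtain V w h where T: "(V, X, Y, w, r, h) \<in> Tri D" using tri_cocone[OF r] by blast
  note w = tri_arr(1)[OF T] and h = tri_arr(3)[OF T]
  have Vo: "V \<in> Ob D" using arr_src[OF w] .
  have "v = zm V W" if W: "W \<in> \<U>" and v: "arr V W v" for W v
  proof -
    have Wo: "W \<in> Ob D" and sWu: "sh D W \<in> \<U>" using W sub sh_essential_image_iff[OF sub ess] by blast+
    note Sv = fmor_arr[OF E v] and Sw = fmor_arr[OF E w]
    note Svh = arr_comp[OF h Sv]
    have "(shm D v \<bullet>\<^bsub>D\<^esub> h) \<bullet>\<^bsub>D\<^esub> r = zm X (sh D W)"
      using arr_assoc[OF r h Sv] tri_comp_zero[OF tri_rotate[OF T]] comp_zero[OF Sv X] by simp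
    then have "shm D v \<bullet>\<^bsub>D\<^esub> h = zm Y (sh D W)" using inj[OF sWu Svh] by simp
    then obtain t where t: "arr (sh D X) (sh D W) t"
      and tw: "t \<bullet>\<^bsub>D\<^esub> (\<ominus>\<^bsub>Hom D (sh D V) (sh D X)\<^esub> shm D w) = shm D v"
      using tri_weak_cokernel[OF tri_rotate[OF tri_rotate[OF T]] Sv] by blast
    obtain u where u: "arr X W u" "shm D u = t"
      using autoequivalence_full[OF Shift_autoequivalence X Wo t] by blast
    obtain y where y: "arr Y W y" "y \<bullet>\<^bsub>D\<^esub> r = u" using sur[OF W u(1)] by blast
    have "u \<bullet>\<^bsub>D\<^esub> w = zm V W"
      using arr_assoc[OF w r y(1)] y(2) tri_comp_zero[OF T] comp_zero[OF y(1) Vo] by simp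
    then have "t \<bullet>\<^bsub>D\<^esub> shm D w = shm D (zm V W)" using fmor_comp[OF E w u(1)] u(2) by simp
    then have "shm D v = shm D (zm V W)"
      using tw comp_neg[OF t Sw] shm_zero[OF Vo Wo] neg_zero arr_src[OF Sv] arr_tgt[OF Sv] by simp
    then show ?thesis
      using autoequivalence_faithful[OF Shift_autoequivalence v arr_zero[OF Vo Wo]] by simp
  qed
  then have "Mor D V W = {zm V W}" if "W \<in> \<U>" for W
    using that sub Vo hom_trivial_iff[of V W] by blast
  then have "V \<in> left_perp \<U>" using Vo by (simp add: left_perp_def hom_vanishes_def)
  then show ?thesis using Y T by blast
qed

text \<open>In the coreflection triangle of such an \<open>X\<close> the map to the perpendicular
  term vanishes. So the identity of \<open>X\<close> lifts along \<open>f\<close>, and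
  \<open>X\<close> is a retract of \<open>Y\<close>.\<close>

lemma perp_perp_subset:
  assumes U: "thick_subcategory D \<U>" and split: "idempotents_split_on D \<U>"
    and fin: "contravariantly_finite D \<U>"
  shows "left_perp (right_perp D \<U>) \<subseteq> \<U>"
proof
  fix X assume X: "X \<in> left_perp (right_perp D \<U>)"
  then have Xo: "X \<in> Ob D" by (simp add: left_perp_def)
  obtain Y V f g h where Y: "Y \<in> \<U>" and V: "V \<in> right_perp D \<U>" and T: "(Y, X, V, f, g, h) \<in> Tri D"
    using coreflection_triangle[OF assms Xo] by blast
  note f = tri_arr(1)[OF T] and g = tri_arr(2)[OF T]
  have "g = zm X V"
    using X V arr_Mor[OF g] by (auto simp: left_perp_def hom_vanishes_def)
  then have "g \<bullet>\<^bsub>D\<^esub> Idm D X = zm X V" using comp_id[OF g] by simp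
  then obtain s where "arr X Y s" "f \<bullet>\<^bsub>D\<^esub> s = Idm D X" using tri_weak_kernel[OF T arr_Idm[OF Xo]] by blast
  then show "X \<in> \<U>" using thick_retract[OF U split Y _ f] by blast
qed

section \<open>Serre duality and perpendicular categories\<close>

text \<open>The Serre isomorphism is a bijection onto a dual, and by finite dimension a dual is a
  singleton exactly when its space is zero.\<close>

lemma serre_hom_trivial_iff:
  assumes fin: "hom_finite K D" and S: "serre_functor K D S" and o: "X \<in> Ob D" "Y \<in> Ob D"
  shows "Mor D Y (fob S X) = {zm Y (fob S X)} \<longleftrightarrow> Mor D X Y = {zm X Y}"
proof -
  obtain \<eta> where "linear_iso K (Hom D X Y) (dual_space K (Hom D Y (fob S X))) \<eta>"
    using S o unfolding serre_functor_def by blast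
  then have bij: "bij_betw \<eta> (Mor D X Y) (carrier (dual_space K (Hom D Y (fob S X))))"
    by (simp add: linear_iso_def)
  have So: "fob S X \<in> Ob D"
    using S o autoequivalence_endofunctor fob_Ob unfolding serre_functor_def by blast
  have K: "field K" by unfold_locales
  have "is_singleton (carrier (dual_space K (Hom D Y (fob S X)))) \<longleftrightarrow> Mor D Y (fob S X) = {zm Y (fob S X)}"
    using dual_space_trivial_iff[OF K Hom_module[OF o(2) So]] fin o So by (simp add: hom_finite_def)
  moreover have "is_singleton (carrier (dual_space K (Hom D Y (fob S X)))) \<longleftrightarrow> is_singleton (Mor D X Y)"
    using bij_betw_same_card[OF bij] by (simp add: is_singleton_altdef)
  moreover have "is_singleton (Mor D X Y) \<longleftrightarrow> Mor D X Y = {zm X Y}"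
    using arr_Mor[OF arr_zero[OF o]] by (auto simp: is_singleton_def)
  ultimately show ?thesis by simp
qed

text \<open>Object by object, \<open>Hom(T, S U)\<close> vanishes exactly when
  \<open>Hom(U, T)\<close> does. Thus reflection into \<open>S\<U>\<close> yields triangles whose
  first term lies in \<open>\<U>\<^sup>\<bottom>\<close>.\<close>

lemma left_perp_serre_image:
  assumes fin: "hom_finite K D" and S: "serre_functor K D S" and sub: "\<U> \<subseteq> Ob D"
  shows "left_perp (essential_image D S \<U>) = right_perp D \<U>"
proof -
  have A: "autoequivalence D S" using S by (simp add: serre_functor_def)
  note E = autoequivalence_endofunctor[OF A]
  have "hom_vanishes D {T} (essential_image D S \<U>) \<longleftrightarrow> hom_vanishes D \<U> {T}" if T: "T \<in> Ob D" for T
  proof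
    assume *: "hom_vanishes D {T} (essential_image D S \<U>)"
    have "Mor D U T = {zm U T}" if U: "U \<in> \<U>" for U
      using * fob_essential_image[OF E sub U] serre_hom_trivial_iff[OF fin S _ T, of U] U sub
      unfolding hom_vanishes_def by blast
    then show "hom_vanishes D \<U> {T}" by (simp add: hom_vanishes_def)
  next
    assume *: "hom_vanishes D \<U> {T}"
    have "Mor D T V = {zm T V}" if V: "V \<in> essential_image D S \<U>" for V
    proof -
      obtain U where U: "U \<in> \<U>" "V \<in> Ob D" "isomorphic D (fob S U) V"
        using V by (auto simp: essential_image_def)
      have Uo: "U \<in> Ob D" using U sub by blast
      have "Mor D T (fob S U) = {zm T (fob S U)}"
        using serre_hom_trivial_iff[OF fin S Uo T] * U by (simp add: hom_vanishes_def)
      then show ?thesis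
        using hom_trivial_isomorphic[OF T T fob_Ob[OF E Uo] U(2) isomorphic_refl[OF T] U(3)] by blast
    qed
    then show "hom_vanishes D {T} (essential_image D S \<U>)" by (simp add: hom_vanishes_def)
  qed
  then show ?thesis by (auto simp: left_perp_def right_perp_def)
qed

text \<open>Write \<open>X\<close> as \<open>S X'\<close> up to isomorphism. Duality turns the
  vanishing of \<open>Hom(V, S X')\<close> into that of \<open>Hom(X', V)\<close>, so
  \<open>perp_perp_subset\<close> puts \<open>X'\<close> into \<open>\<U>\<close>. The other
  inclusion is \<open>left_perp_serre_image\<close> read backwards.\<close>

lemma right_perp_right_perp:
  assumes fin: "hom_finite K D" and S: "serre_functor K D S"
    and U: "thick_subcategory D \<U>" and split: "idempotents_split_on D \<U>"
    and cf: "contravariantly_finite D \<U>"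
  shows "right_perp D (right_perp D \<U>) = essential_image D S \<U>"
proof -
  have sub: "\<U> \<subseteq> Ob D" using U tri_sub_Ob by (simp add: thick_subcategory_def)
  have A: "autoequivalence D S" using S by (simp add: serre_functor_def)
  note E = autoequivalence_endofunctor[OF A]
  show ?thesis
  proof (intro equalityI subsetI)
    fix X assume X: "X \<in> right_perp D (right_perp D \<U>)"
    then have Xo: "X \<in> Ob D" by (simp add: right_perp_def)
    obtain X' where X': "X' \<in> Ob D" "isomorphic D (fob S X') X"
      using autoequivalence_surj[OF A Xo] by blast
    note So = fob_Ob[OF E X'(1)]
    have "Mor D X' V = {zm X' V}" if V: "V \<in> right_perp D \<U>" for V
    proof -
      have Vo: "V \<in> Ob D" using V by (simp add: right_perp_def)
      have "Mor D V X = {zm V X}" using X V by (simp add: right_perp_def hom_vanishes_def)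
      then have "Mor D V (fob S X') = {zm V (fob S X')}"
        using hom_trivial_isomorphic[OF Vo Vo Xo So isomorphic_refl[OF Vo]]
          isomorphic_sym[OF So Xo X'(2)] by blast
      then show ?thesis using serre_hom_trivial_iff[OF fin S X'(1) Vo] by blast
    qed
    then have "X' \<in> left_perp (right_perp D \<U>)"
      using X'(1) by (simp add: left_perp_def hom_vanishes_def)
    then show "X \<in> essential_image D S \<U>"
      using perp_perp_subset[OF U split cf] X'(2) Xo by (auto simp: essential_image_def)
  next
    fix X assume X: "X \<in> essential_image D S \<U>"
    then have "X \<in> Ob D" by (simp add: essential_image_def)
    moreover have "Mor D V X = {zm V X}" if "V \<in> right_perp D \<U>" for V
      using that X unfolding left_perp_serre_image[OF fin S sub, symmetric]
      by (simp add: left_perp_def hom_vanishes_def)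
    ultimately show "X \<in> right_perp D (right_perp D \<U>)"
      by (simp add: right_perp_def hom_vanishes_def)
  qed
qed

text \<open>The invariant of the induction: it is carried by the odd members of the sequence, and
  \<open>S\<close> hands it from one to the next.\<close>

definition approximable :: "'o set \<Rightarrow> bool" where
  "approximable \<U> \<longleftrightarrow> thick_subcategory D \<U> \<and> idempotents_split_on D \<U> \<and> functorially_finite D \<U>"

text \<open>One round of the induction, that is, two steps of the sequence: the first t-structure
  comes from coreflection into \<open>\<U>\<close>, the second from reflection into
  \<open>S\<U>\<close>.\<close>

lemma approximable_perp:
  assumes fin: "hom_finite K D" and S: "serre_functor K D S" and U: "approximable \<U>"
  shows "approximable (essential_image D S \<U>)"
    and "triangulated_subcategory D (right_perp D \<U>)"
    and "stable_t_structure D \<U> (right_perp D \<U>)"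
    and "stable_t_structure D (right_perp D \<U>) (essential_image D S \<U>)"
    and "right_perp D (right_perp D \<U>) = essential_image D S \<U>"
proof -
  have th: "thick_subcategory D \<U>" and sp: "idempotents_split_on D \<U>"
    and cf: "contravariantly_finite D \<U>" and co: "covariantly_finite D \<U>"
    using U by (auto simp: approximable_def functorially_finite_def)
  have A: "autoequivalence D S" using S by (simp add: serre_functor_def)
  have TU: "triangulated_subcategory D \<U>" using th by (simp add: thick_subcategory_def)
  note sub = tri_sub_Ob[OF TU] and ess = tri_sub_ess[OF TU]
  have thP: "thick_subcategory D (right_perp D \<U>)" by (rule thick_right_perp[OF sub ess])
  then show TP: "triangulated_subcategory D (right_perp D \<U>)" by (simp add: thick_subcategory_def)
  show PP: "right_perp D (right_perp D \<U>) = essential_image D S \<U>"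
    by (rule right_perp_right_perp[OF fin S th sp cf])
  have thS: "thick_subcategory D (essential_image D S \<U>)"
    using thick_right_perp[OF tri_sub_Ob[OF TP] tri_sub_ess[OF TP]] PP by simp
  then have TS: "triangulated_subcategory D (essential_image D S \<U>)" by (simp add: thick_subcategory_def)
  note spS = idempotents_split_on_essential_image[OF A sub sp]
    and cfS = contravariantly_finite_essential_image[OF A sub cf]
    and coS = covariantly_finite_essential_image[OF A sub co]
  show "approximable (essential_image D S \<U>)"
    using thS spS cfS coS by (simp add: approximable_def functorially_finite_def)
  show "stable_t_structure D \<U> (right_perp D \<U>)"
    unfolding stable_t_structure_def
    using sub tri_sub_Ob[OF TP] ess tri_sub_ess[OF TP] coreflection_triangle[OF th sp cf]
    by (auto simp: hom_vanishes_def right_perp_def)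
  have "hom_vanishes D (right_perp D \<U>) (essential_image D S \<U>)"
    unfolding PP[symmetric] by (auto simp: hom_vanishes_def right_perp_def)
  then show "stable_t_structure D (right_perp D \<U>) (essential_image D S \<U>)"
    unfolding stable_t_structure_def
    using tri_sub_Ob[OF TS] tri_sub_Ob[OF TP] tri_sub_ess[OF TS] tri_sub_ess[OF TP]
      reflection_triangle[OF thS spS coS] left_perp_serre_image[OF fin S sub] by simp
qed

section \<open>Periodicity\<close>

lemma endofunctor_power: "endofunctor D F \<Longrightarrow> endofunctor D (power_endo F j)"
proof (induction j)
  case 0
  then show ?case using endofunctor_id by (simp add: power_endo_def id_endo_def id_def)
next
  case (Suc j)
  then show ?case using endofunctor_comp[of F "power_endo F j"] by (simp add: power_endo_def comp_endo_def)
qed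

lemma essential_image_power_0:
  assumes "\<U> \<subseteq> Ob D" "\<And>X Y. X \<in> \<U> \<Longrightarrow> Y \<in> Ob D \<Longrightarrow> isomorphic D X Y \<Longrightarrow> Y \<in> \<U>"
  shows "essential_image D (power_endo F 0) \<U> = \<U>"
  unfolding essential_image_def power_endo_def using assms isomorphic_refl by simp blast

lemma essential_image_power_Suc:
  assumes "endofunctor D F" "\<U> \<subseteq> Ob D"
  shows "essential_image D (power_endo F (Suc j)) \<U> = essential_image D F (essential_image D (power_endo F j) \<U>)"
  using essential_image_comp[OF assms(1) endofunctor_power[OF assms(1)] assms(2), of j]
  by (simp add: power_endo_def comp_endo_def)

lemma essential_image_power_fixed:
  assumes "endofunctor D F" "\<U> \<subseteq> Ob D" "\<And>X Y. X \<in> \<U> \<Longrightarrow> Y \<in> Ob D \<Longrightarrow> isomorphic D X Y \<Longrightarrow> Y \<in> \<U>"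
    and "essential_image D F \<U> = \<U>"
  shows "essential_image D (power_endo F j) \<U> = \<U>"
  using assms by (induction j) (simp_all add: essential_image_power_0 essential_image_power_Suc)

text \<open>For negative \<open>m\<close> the quasi-inverse is applied to
  \<open>\<U> = \<Sigma>\<U>\<close>, which gives
  \<open>\<Sigma>'\<U> = \<Sigma>'\<Sigma>\<U> = \<U>\<close>. So powers of either sign fix
  \<open>\<U>\<close>.\<close>

lemma essential_image_int_power_Shift:
  assumes U: "triangulated_subcategory D \<U>" and Q: "quasi_inverse D (Shift D) \<Sigma>'"
  shows "essential_image D (int_power_endo (Shift D) \<Sigma>' m) \<U> = \<U>"
proof -
  note sub = tri_sub_Ob[OF U] and ess = tri_sub_ess[OF U] and iso = tri_sub_iso[OF U]
  have E: "endofunctor D \<Sigma>'" and nat: "naturally_isomorphic D (comp_endo \<Sigma>' (Shift D)) id_endo"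
    using Q by (auto simp: quasi_inverse_def)
  have "essential_image D \<Sigma>' \<U> = essential_image D (comp_endo \<Sigma>' (Shift D)) \<U>"
    using essential_image_comp[OF E Shift_endofunctor sub] ess by simp
  also have "\<dots> = essential_image D id_endo \<U>"
    by (rule essential_image_naturally_isomorphic[OF endofunctor_comp[OF E Shift_endofunctor] endofunctor_id sub nat])
  also have "\<dots> = \<U>"
    unfolding essential_image_def id_endo_def using sub iso isomorphic_refl by simp blast
  finally have "essential_image D \<Sigma>' \<U> = \<U>" .
  then show ?thesis
    using essential_image_power_fixed[OF _ sub iso] E Shift_endofunctor ess by (simp add: int_power_endo_def)
qed

lemma perp_sequence:
  assumes fin: "hom_finite K D" and S: "serre_functor K D S" and U1: "approximable (\<U> 1)"
    and step: "\<And>i. i \<ge> 1 \<Longrightarrow> \<U> (i + 1) = right_perp D (\<U> i)"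
  shows "approximable (\<U> (2 * j + 1)) \<and> \<U> (2 * j + 1) = essential_image D (power_endo S j) (\<U> 1)"
proof (induction j)
  case 0
  have T1: "triangulated_subcategory D (\<U> 1)" using U1 by (simp add: approximable_def thick_subcategory_def)
  show ?case using U1 essential_image_power_0[OF tri_sub_Ob[OF T1] tri_sub_iso[OF T1]] by simp
next
  case (Suc j)
  have sub: "\<U> 1 \<subseteq> Ob D" using U1 tri_sub_Ob by (simp add: approximable_def thick_subcategory_def)
  have E: "endofunctor D S" using S autoequivalence_endofunctor by (simp add: serre_functor_def)
  have "\<U> (2 * Suc j + 1) = right_perp D (right_perp D (\<U> (2 * j + 1)))"
    using step[of "2 * j + 1"] step[of "2 * j + 2"] by simp
  also have "\<dots> = essential_image D S (\<U> (2 * j + 1))"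
    using approximable_perp(5)[OF fin S] Suc by blast
  finally have eq: "\<U> (2 * Suc j + 1) = essential_image D S (\<U> (2 * j + 1))" .
  have "approximable (\<U> (2 * Suc j + 1))" unfolding eq using approximable_perp(1)[OF fin S] Suc by blast
  moreover have "\<U> (2 * Suc j + 1) = essential_image D (power_endo S (Suc j)) (\<U> 1)"
    unfolding eq essential_image_power_Suc[OF E sub] using Suc by simp
  ultimately show ?case by blast
qed

end

theorem proposition0p4:
  fixes K :: "'k ring" and D :: "('o, 'm, 'k) tricat"
    and m :: int and n :: nat and \<U> :: "nat \<Rightarrow> 'o set"
  assumes "k_linear_triangulated_category K D"
    and "hom_finite K D"
    and "fractionally_calabi_yau K D m n"
    and "thick_subcategory D (\<U> 1)"
    and "functorially_finite D (\<U> 1)"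
    and "idempotents_split_on D (\<U> 1)"
    and "\<And>i. i \<ge> 1 \<Longrightarrow> \<U> (i + 1) = right_perp D (\<U> i)"
  shows "\<exists>l. 0 < l \<and> l dvd 2 * n \<and> gon_of_recollements D l \<U>"
proof -
  interpret k_linear_triangulated_category K D by fact
  note fin = assms(2) and step = assms(7)
  obtain S \<Sigma>' where S: "serre_functor K D S" and Q: "quasi_inverse D (Shift D) \<Sigma>'"
    and nat: "naturally_isomorphic D (power_endo S n) (int_power_endo (Shift D) \<Sigma>' m)" and n: "0 < n"
    using assms(3) unfolding fractionally_calabi_yau_def by blast
  have U1: "approximable (\<U> 1)" using assms(4-6) by (simp add: approximable_def)
  have T1: "triangulated_subcategory D (\<U> 1)" using assms(4) by (simp add: thick_subcategory_def)
  note seq = perp_sequence[OF fin S U1 step]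
  have ES: "endofunctor D S" using S autoequivalence_endofunctor by (simp add: serre_functor_def)
  have E\<Sigma>: "endofunctor D (int_power_endo (Shift D) \<Sigma>' m)"
    using Q endofunctor_power by (simp add: int_power_endo_def quasi_inverse_def)
  \<comment> \<open>Naturally isomorphic functors have the same essential images, so the
    \<open>n\<close>-th power of \<open>S\<close> may be exchanged for the power of the translation,
    which fixes \<open>\<U> 1\<close>.\<close>
  have "\<U> (2 * n + 1) = essential_image D (int_power_endo (Shift D) \<Sigma>' m) (\<U> 1)"
    using seq[of n] essential_image_naturally_isomorphic[OF endofunctor_power[OF ES] E\<Sigma> tri_sub_Ob[OF T1] nat]
    by simp
  then have period: "\<U> (2 * n + 1) = \<U> 1" using essential_image_int_power_Shift[OF T1 Q] by simp
  \<comment> \<open>An odd \<open>i\<close> starts a round and gets its first t-structure; an even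
    \<open>i\<close> is the perpendicular category in the middle of the round started at
    \<open>i - 1\<close>.\<close>
  have pair: "triangulated_subcategory D (\<U> i) \<and> stable_t_structure D (\<U> i) (\<U> (i + 1))" if i: "i \<ge> 1" for i
  proof (cases "odd i")
    case True
    then obtain j where j: "i = 2 * j + 1" by (elim oddE)
    have A: "approximable (\<U> i)" using seq[of j] unfolding j by blast
    then have "triangulated_subcategory D (\<U> i)" by (simp add: approximable_def thick_subcategory_def)
    then show ?thesis using approximable_perp(3)[OF fin S A] step[OF i] by simp
  next
    case False
    then have "odd (i - 1)" using i by simp
    then obtain j where "i - 1 = 2 * j + 1" by (elim oddE)
    then have j: "i = 2 * j + 1 + 1" using i by simp
    have A: "approximable (\<U> (2 * j + 1))" using seq by blast
    have "\<U> i = right_perp D (\<U> (2 * j + 1))" using step[of "2 * j + 1"] j by simp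
    moreover from this have "\<U> (i + 1) = essential_image D S (\<U> (2 * j + 1))"
      using step[OF i] approximable_perp(5)[OF fin S A] by simp
    ultimately show ?thesis using approximable_perp(2,4)[OF fin S A] by simp
  qed
  \<comment> \<open>The tuple closes up here: the successor of its last member is
    \<open>\<U> (2 * n + 1)\<close>, which periodicity identifies with
    \<open>\<U> 1\<close>.\<close>
  have "stable_t_structure D (\<U> (2 * n)) (\<U> 1)" using pair[of "2 * n"] n period by simp
  then have "gon_of_recollements D (2 * n) \<U>"
    unfolding gon_of_recollements_def using pair by auto
  then show ?thesis using n by (intro exI[of _ "2 * n"]) simp
qed

end
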